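(* Let $\Bbbk$ be an uncountable algebraically closed field of characteristic zero, $\mathfrak q=\mathfrak q_2$ the queer Lie superalgebra over $\Bbbk$ and $\mathfrak{sq}=\mathfrak{sq}_2\subset\mathfrak q$. The restriction functor from $\mathfrak q$-supermodules to $\mathfrak{sq}$-supermodules induces a bijection between the set of isomorphism classes (up to parity change) of simple typical $\mathfrak q$-supermodules and the set of isomorphism classes (up to parity change) of simple typical $\mathfrak{sq}$-supermodules.
   Context: The Lie superalgebra $\mathfrak q=\mathfrak q_2$ consists of the block matrices $\mathtt M(A,B)=\begin{pmatrix}A&B\\ B&A\end{pmatrix}$, $A,B\in\mathfrak{gl}_2(\Bbbk)$; the even part consists of the $\mathtt M(A,0)$ and is identified with $\mathtt g=\mathfrak{gl}_2(\Bbbk)$, the odd part consists of the $\mathtt M(0,B)$; the superbracket is $[X,Y]=XY-(-1)^{\overline X\,\overline Y}YX$ for homogeneous $X,Y$. With matrix units $E_{ij}$ put $H_i=\mathtt M(E_{ii},0)$, $\overline E=\mathtt M(0,E_{12})$, $\overline F=\mathtt M(0,E_{21})$, $\overline H_i=\mathtt M(0,E_{ii})$. The subsuperalgebra $\mathfrak{sq}=\mathfrak{sq}_2$ of $\mathfrak q$ is generated by $\mathtt g$ and the elements $\overline E$, $\overline F$, $\overline H_1-\overline H_2$. Supermodules are $\mathbb Z/2\mathbb Z$-graded, homomorphisms of supermodules are of degree zero, simple supermodules are those without proper nonzero graded subsupermodules. The element $H_1+H_2$ is central in $\mathfrak q$ and acts on each simple $\mathfrak q$- or $\mathfrak{sq}$-supermodule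 by a scalar; the supermodule is called typical if this scalar is nonzero, and atypical if it is zero. *)

theory Defs
  imports "HOL-Analysis.Analysis" "HOL-Library.Z2" "HOL-Computational_Algebra.Polynomial"
begin

text \<open>Parities are elements of \<^typ>\<open>bit\<close>, the field with two elements; \<open>0\<close> is even,
  \<open>1\<close> is odd.\<close>

type_synonym 'k gl2 = "'k ^ 2 ^ 2"
type_synonym 'k gl22 = "'k ^ (2 + 2) ^ (2 + 2)"

definition mscale :: "'k::field \<Rightarrow> 'k ^ 'n ^ 'm \<Rightarrow> 'k ^ 'n ^ 'm" where
  "mscale c = map_matrix ((*) c)"

definition block :: "'k::field gl2 \<Rightarrow> 'k gl2 \<Rightarrow> 'k gl22" where
  "block A B = (\<chi> i j. case (i, j) of
      (Inl a, Inl b) \<Rightarrow> A $ a $ b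
    | (Inl a, Inr b) \<Rightarrow> B $ a $ b
    | (Inr a, Inl b) \<Rightarrow> B $ a $ b
    | (Inr a, Inr b) \<Rightarrow> A $ a $ b)"

definition munit :: "2 \<Rightarrow> 2 \<Rightarrow> 'k::field gl2" where
  "munit i j = (\<chi> a b. if a = i \<and> b = j then 1 else 0)"

definition q2 :: "'k::field gl22 set" where
  "q2 = {block A B |A B. True}"

definition q2_part :: "bit \<Rightarrow> 'k::field gl22 set" where
  "q2_part p = (if p = 0 then {block A 0 |A. True} else {block 0 B |B. True})"

definition ksign :: "bit \<Rightarrow> bit \<Rightarrow> 'k::field" where
  "ksign p q = (if p * q = 1 then - 1 else 1)"

text \<open>The superbracket of homogeneous elements \<open>X\<close>, \<open>Y\<close> of parities \<open>p\<close>, \<open>q\<close>.\<close>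

definition sbracket :: "bit \<Rightarrow> bit \<Rightarrow> 'k::field gl22 \<Rightarrow> 'k gl22 \<Rightarrow> 'k gl22" where
  "sbracket p q X Y = X ** Y - mscale (ksign p q) (Y ** X)"

definition subsuperalgebra :: "'k::field gl22 set \<Rightarrow> bool" where
  "subsuperalgebra L \<longleftrightarrow>
     L \<subseteq> q2 \<and> module.subspace mscale L \<and>
     (\<forall>X\<in>L. \<exists>X0 \<in> L \<inter> q2_part 0. \<exists>X1 \<in> L \<inter> q2_part 1. X = X0 + X1) \<and>
     (\<forall>p q. \<forall>X \<in> L \<inter> q2_part p. \<forall>Y \<in> L \<inter> q2_part q. sbracket p q X Y \<in> L)"

definition H :: "2 \<Rightarrow> 'k::field gl22" where "H i = block (munit i i) 0"
definition Ebar :: "'k::field gl22" where "Ebar = block 0 (munit 1 2)"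
definition Fbar :: "'k::field gl22" where "Fbar = block 0 (munit 2 1)"
definition Hbar :: "2 \<Rightarrow> 'k::field gl22" where "Hbar i = block 0 (munit i i)"

definition sq2 :: "'k::field gl22 set" where
  "sq2 = subsuperalgebra hull (q2_part 0 \<union> {Ebar, Fbar, Hbar 1 - Hbar 2})"

text \<open>The underlying graded vector spaces of supermodules are pairs of independent subspaces
  \<open>comp V 0\<close>, \<open>comp V 1\<close> of an ambient vector space, which is given by its scalar
  multiplication \<open>scl\<close> and serves as the universe in which sets of isomorphism classes are
  formed; any set of supermodules can be realised, up to isomorphism, in a sufficiently large one.
  The values of \<open>act V X v\<close> are relevant only for \<open>X\<close> in the superalgebra and \<open>v\<close> in
  the carrier.\<close>

record ('k, 'v) supermod =
  comp :: "bit \<Rightarrow> 'v set"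
  act :: "'k gl22 \<Rightarrow> 'v \<Rightarrow> 'v"

definition carr :: "('k, 'v::ab_group_add) supermod \<Rightarrow> 'v set" where
  "carr V = {v0 + v1 |v0 v1. v0 \<in> comp V 0 \<and> v1 \<in> comp V 1}"

definition linear_on_carr ::
    "('k::field \<Rightarrow> 'v::ab_group_add \<Rightarrow> 'v) \<Rightarrow> 'v set \<Rightarrow> ('v \<Rightarrow> 'v) \<Rightarrow> bool" where
  "linear_on_carr scl S f \<longleftrightarrow>
     (\<forall>u\<in>S. \<forall>v\<in>S. f (u + v) = f u + f v) \<and> (\<forall>c. \<forall>v\<in>S. f (scl c v) = scl c (f v))"

definition supermodule ::
    "('k::field \<Rightarrow> 'v::ab_group_add \<Rightarrow> 'v) \<Rightarrow> 'k gl22 set \<Rightarrow> ('k, 'v) supermod \<Rightarrow> bool" where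
  "supermodule scl L V \<longleftrightarrow>
     (\<forall>i. module.subspace scl (comp V i)) \<and> comp V 0 \<inter> comp V 1 = {0} \<and>
     (\<forall>X\<in>L. linear_on_carr scl (carr V) (act V X)) \<and>
     (\<forall>X\<in>L. \<forall>Y\<in>L. \<forall>v\<in>carr V. act V (X + Y) v = act V X v + act V Y v) \<and>
     (\<forall>c. \<forall>X\<in>L. \<forall>v\<in>carr V. act V (mscale c X) v = scl c (act V X v)) \<and>
     (\<forall>p i. \<forall>X \<in> L \<inter> q2_part p. \<forall>v\<in>comp V i. act V X v \<in> comp V (p + i)) \<and>
     (\<forall>p q. \<forall>X \<in> L \<inter> q2_part p. \<forall>Y \<in> L \<inter> q2_part q. \<forall>v\<in>carr V.
        act V (sbracket p q X Y) v =
          act V X (act V Y v) - scl (ksign p q) (act V Y (act V X v)))"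

text \<open>Graded subsupermodules are given by their homogeneous components.\<close>

definition subsupermodule ::
    "('k::field \<Rightarrow> 'v::ab_group_add \<Rightarrow> 'v) \<Rightarrow> 'k gl22 set \<Rightarrow> ('k, 'v) supermod \<Rightarrow>
     (bit \<Rightarrow> 'v set) \<Rightarrow> bool" where
  "subsupermodule scl L V N \<longleftrightarrow>
     (\<forall>i. module.subspace scl (N i) \<and> N i \<subseteq> comp V i) \<and>
     (\<forall>p i. \<forall>X \<in> L \<inter> q2_part p. \<forall>v\<in>N i. act V X v \<in> N (p + i))"

definition simple_supermodule ::
    "('k::field \<Rightarrow> 'v::ab_group_add \<Rightarrow> 'v) \<Rightarrow> 'k gl22 set \<Rightarrow> ('k, 'v) supermod \<Rightarrow> bool" where
  "simple_supermodule scl L V \<longleftrightarrow>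
     supermodule scl L V \<and> comp V \<noteq> (\<lambda>_. {0}) \<and>
     (\<forall>N. subsupermodule scl L V N \<longrightarrow> N = (\<lambda>_. {0}) \<or> N = comp V)"

definition typical ::
    "('k::field \<Rightarrow> 'v::ab_group_add \<Rightarrow> 'v) \<Rightarrow> ('k, 'v) supermod \<Rightarrow> bool" where
  "typical scl V \<longleftrightarrow> (\<exists>c. c \<noteq> 0 \<and> (\<forall>v\<in>carr V. act V (H 1 + H 2) v = scl c v))"

definition simple_typical ::
    "('k::field \<Rightarrow> 'v::ab_group_add \<Rightarrow> 'v) \<Rightarrow> 'k gl22 set \<Rightarrow> ('k, 'v) supermod set" where
  "simple_typical scl L = {V. simple_supermodule scl L V \<and> typical scl V}"

definition isomorphic ::
    "('k::field \<Rightarrow> 'v::ab_group_add \<Rightarrow> 'v) \<Rightarrow> 'k gl22 set \<Rightarrow>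
     ('k, 'v) supermod \<Rightarrow> ('k, 'v) supermod \<Rightarrow> bool" where
  "isomorphic scl L V W \<longleftrightarrow> (\<exists>f.
     bij_betw f (carr V) (carr W) \<and> linear_on_carr scl (carr V) f \<and>
     (\<forall>i. f ` comp V i \<subseteq> comp W i) \<and>
     (\<forall>X\<in>L. \<forall>v\<in>carr V. f (act V X v) = act W X (f v)))"

text \<open>Parity change leaves the action untouched. The other common convention, in which odd
  elements act with an extra sign, gives an isomorphic supermodule, via multiplication of
  homogeneous vectors by the sign of their parity.\<close>

definition parity_change :: "('k, 'v) supermod \<Rightarrow> ('k, 'v) supermod" where
  "parity_change V = V\<lparr>comp := \<lambda>i. comp V (i + 1)\<rparr>"

definition iso_up_to_parity ::
    "('k::field \<Rightarrow> 'v::ab_group_add \<Rightarrow> 'v) \<Rightarrow> 'k gl22 set \<Rightarrow>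
     (('k, 'v) supermod \<times> ('k, 'v) supermod) set" where
  "iso_up_to_parity scl L =
     {(V, W). V \<in> simple_typical scl L \<and> W \<in> simple_typical scl L \<and>
        (isomorphic scl L V W \<or> isomorphic scl L V (parity_change W))}"

definition iso_classes ::
    "('k::field \<Rightarrow> 'v::ab_group_add \<Rightarrow> 'v) \<Rightarrow> 'k gl22 set \<Rightarrow> ('k, 'v) supermod set set" where
  "iso_classes scl L = simple_typical scl L // iso_up_to_parity scl L"

definition res :: "'k gl22 set \<Rightarrow> ('k, 'v) supermod \<Rightarrow> ('k, 'v) supermod" where
  "res L V = V\<lparr>act := restrict (act V) L\<rparr>"

end

theory Submission
  imports Defs
begin

text \<open>
  Let \<open>x\<close>, \<open>y\<close>, \<open>h\<close> be the standard basis of \<open>sl\<^sub>2\<close>, \<open>E\<close>, \<open>F\<close>, \<open>K\<close> its odd copy in \<open>sq\<close>, and let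
  \<open>z = H\<^sub>1 + H\<^sub>2\<close> act by a scalar \<open>c \<noteq> 0\<close>. Then \<open>E\<close>, \<open>F\<close>, \<open>K\<close> generate a Clifford algebra of rank three.
  The odd element \<open>w = K(EF - FE)\<close> commutes, without signs, with \<open>sq\<close>, and \<open>w\<^sup>2 = c\<^sup>3\<close>; so it identifies each typical
  \<open>sq\<close>-supermodule with its parity change. There is an odd element \<open>T\<close> of the enveloping algebra of \<open>sq\<close>, up
  to a multiple of \<open>w\<close> an odd Casimir element, whose supercommutators with \<open>x\<close>, \<open>y\<close>, \<open>h\<close>, \<open>E\<close>, \<open>F\<close>, \<open>K\<close> are
  those of the missing odd element \<open>Z = M(0, 1)\<close> of \<open>q\<close>. Let \<open>s\<close> be the parity operator.

  On a simple typical \<open>q\<close>-supermodule, \<open>(Z - T) w s\<close> is an even endomorphism, hence a scalar by Schur's lemma, so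
  that \<open>Z = T + l s w\<close> for a scalar \<open>l\<close>. Therefore graded \<open>sq\<close>-subsupermodules are stable under \<open>Z\<close>, and the
  restriction is simple. Conversely, on a simple typical \<open>sq\<close>-supermodule \<open>T\<^sup>2\<close> is a scalar, and
  \<open>Z = T + l s w\<close> defines an action of \<open>q\<close> precisely if \<open>T\<^sup>2 - l\<^sup>2 c\<^sup>3 = c\<close>. The two solutions \<open>l\<close> and \<open>-l\<close>
  are interchanged by \<open>w\<close> and so differ by a parity change.

  Schur's lemma holds for the simple supermodules at hand because their dimension is countable and the field is
  uncountable.
\<close>

section \<open>The Clifford element and the odd Casimir element\<close>

text \<open>Products are normalised to right-nested form, where the left side \<open>a * b\<close>
  of a relation is hidden inside a longer word; this variant of the relation rewrites there
  too.\<close>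

lemma assoc_rule: "a * b = (c::'r::semigroup_mult) \<Longrightarrow> a * (b * r) = c * r"
  by (simp add: mult.assoc[symmetric])

text \<open>The relations are oriented towards the order \<open>z\<close>, \<open>x\<close>,
  \<open>y\<close>, \<open>h\<close>, \<open>E\<close>, \<open>F\<close>, \<open>K\<close>. As
  rewrite rules they bring every word into PBW form, so that identities can be proved by normalising
  both sides. The rule for the square of an odd element is half of its superbracket with
  itself.\<close>

locale sq_relations =
  fixes x y h z E F K :: "'r::ring"
  assumes yx: "y * x = x * y - h" and hx: "h * x = x * h + (x + x)" and hy: "h * y = y * h - (y + y)"
    and Ex: "E * x = x * E" and Fx: "F * x = x * F - K" and Kx: "K * x = x * K + (E + E)"
    and Ey: "E * y = y * E + K" and Fy: "F * y = y * F" and Ky: "K * y = y * K - (F + F)"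
    and Eh: "E * h = h * E - (E + E)" and Fh: "F * h = h * F + (F + F)" and Kh: "K * h = h * K"
    and FE: "F * E = z - E * F" and KE: "K * E = - (E * K)" and KF: "K * F = - (F * K)"
    and EE: "E * E = 0" and FF: "F * F = 0" and KK: "K * K = z"
    and xz: "x * z = z * x" and yz: "y * z = z * y" and hz: "h * z = z * h"
    and Ez: "E * z = z * E" and Fz: "F * z = z * F" and Kz: "K * z = z * K"
begin

lemmas pbw = yx hx hy Ex Fx Kx Ey Fy Ky Eh Fh Kh FE KE KF EE FF KK xz yz hz Ez Fz Kz
lemmas normal_order = pbw pbw[THEN assoc_rule]

text \<open>Up to sign the product of the three orthogonal vectors \<open>K\<close>,
  \<open>E + F\<close>, \<open>E - F\<close>, that is, the volume element of the Clifford
  algebra.\<close>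

definition clif :: 'r where "clif = K * (E * F - F * E)"

text \<open>The first summand is \<open>2z\<close> times the odd Casimir element of the adjoint action of \<open>sl\<^sub>2\<close>; the
  multiple of \<open>clif\<close> is chosen so that the anticommutators with \<open>E\<close>, \<open>F\<close>, \<open>K\<close> become even elements
  of the Lie superalgebra.\<close>

definition ocas :: 'r where
  "ocas = z * (x * F + x * F + y * E + y * E + h * K) - (clif + clif)"

text \<open>In odd rank the volume element is central in the Clifford algebra, and \<open>x\<close>,
  \<open>y\<close>, \<open>h\<close> act on its generators by infinitesimal rotations, which
  preserve volume.\<close>

lemma clif_commute:
  "clif * x = x * clif" "clif * y = y * clif" "clif * h = h * clif" "clif * z = z * clif"
  "clif * E = E * clif" "clif * F = F * clif" "clif * K = K * clif"
  by (simp_all add: clif_def normal_order algebra_simps)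

lemma clif_square: "clif * clif = z * (z * z)"
  by (simp add: clif_def normal_order algebra_simps)

lemma ocas_commute: "ocas * x = x * ocas" "ocas * y = y * ocas" "ocas * h = h * ocas" "ocas * z = z * ocas"
  by (simp_all add: ocas_def clif_def normal_order algebra_simps)

lemma ocas_anticommute:
  "ocas * E + E * ocas = z * (z * (x + x))"
  "ocas * F + F * ocas = z * (z * (y + y))"
  "ocas * K + K * ocas = z * (z * (h + h))"
  by (simp_all add: ocas_def clif_def normal_order algebra_simps)

lemma commute_ocas:
  assumes "P * x = x * P" "P * y = y * P" "P * h = h * P" "P * z = z * P"
    "P * E = E * P" "P * F = F * P" "P * K = K * P"
  shows "P * clif = clif * P" "P * ocas = ocas * P"
  using assms assms[THEN assoc_rule] by (simp_all add: ocas_def clif_def algebra_simps)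

text \<open>Every monomial of \<open>clif\<close> and \<open>ocas\<close> contains an odd number of
  letters \<open>E\<close>, \<open>F\<close>, \<open>K\<close>, so the signs combine to a single
  one. This is applied to the parity operator and to the difference \<open>Z - T\<close>.\<close>

lemma anticommute_ocas:
  assumes "P * x = x * P" "P * y = y * P" "P * h = h * P" "P * z = z * P"
    "P * E = - (E * P)" "P * F = - (F * P)" "P * K = - (K * P)"
  shows "P * clif = - (clif * P)" "P * ocas = - (ocas * P)"
  using assms assms[THEN assoc_rule] by (simp_all add: ocas_def clif_def algebra_simps)

end

section \<open>Additive endomorphisms\<close>

text \<open>The maps are additive rather than linear because a type cannot depend on the scalar
  multiplication \<open>scl\<close>. Linearity is expressed later as commutation with the scalar
  operators \<open>sc c\<close>.\<close>

typedef (overloaded) 'v aend = "{f :: 'v::ab_group_add \<Rightarrow> 'v. \<forall>u v. f (u + v) = f u + f v}"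
  morphisms ap Aend
  by (rule exI[of _ id]) simp

setup_lifting type_definition_aend

lemma ap_add [simp]: "ap f (u + v) = ap f u + ap f v"
  using ap[of f] by simp

text \<open>There is no unit, hence no numerals, since \<open>0 = 1\<close> if the underlying group is trivial.\<close>

instantiation aend :: (ab_group_add) ring
begin

lift_definition zero_aend :: "'a aend" is "\<lambda>_. 0" by simp
lift_definition plus_aend :: "'a aend \<Rightarrow> 'a aend \<Rightarrow> 'a aend" is "\<lambda>f g v. f v + g v" by simp
lift_definition minus_aend :: "'a aend \<Rightarrow> 'a aend \<Rightarrow> 'a aend" is "\<lambda>f g v. f v - g v" by simp
lift_definition uminus_aend :: "'a aend \<Rightarrow> 'a aend" is "\<lambda>f v. - f v" by simp
lift_definition times_aend :: "'a aend \<Rightarrow> 'a aend \<Rightarrow> 'a aend" is "\<lambda>f g v. f (g v)" by simp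

instance
  by standard (transfer; simp add: fun_eq_iff algebra_simps)+

end

lemma ap_simps [simp]:
  "ap 0 v = 0" "ap (f + g) v = ap f v + ap g v" "ap (f - g) v = ap f v - ap g v"
  "ap (- f) v = - ap f v" "ap (f * g) v = ap f (ap g v)"
  by (transfer; simp)+

lemma aend_eqI: "(\<And>v. ap f v = ap g v) \<Longrightarrow> f = g"
  by (simp add: ap_inject[symmetric] fun_eq_iff)

section \<open>The superalgebras\<close>

lemma mscale_nth [simp]: "mscale c A $ i $ j = c * A $ i $ j"
  by (simp add: mscale_def map_matrix_def)

lemma module_mscale: "module (mscale :: 'k::field \<Rightarrow> 'k ^ 'n ^ 'm \<Rightarrow> _)"
  by standard (simp_all add: vec_eq_iff algebra_simps)

lemma block_nth [simp]:
  "block A B $ Inl a $ Inl b = A $ a $ b" "block A B $ Inl a $ Inr b = B $ a $ b"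
  "block A B $ Inr a $ Inl b = B $ a $ b" "block A B $ Inr a $ Inr b = A $ a $ b"
  by (simp_all add: block_def)

lemma gl22_eq_iff:
  "(X :: 'k::field gl22) = Y \<longleftrightarrow> (\<forall>a b. X $ Inl a $ Inl b = Y $ Inl a $ Inl b \<and> X $ Inl a $ Inr b = Y $ Inl a $ Inr b \<and>
     X $ Inr a $ Inl b = Y $ Inr a $ Inl b \<and> X $ Inr a $ Inr b = Y $ Inr a $ Inr b)"
  unfolding vec_eq_iff by (metis sumE)

lemma block_eq_iff [simp]: "block A B = block C D \<longleftrightarrow> A = C \<and> B = D"
  by (auto simp: gl22_eq_iff) (auto simp: vec_eq_iff)

lemma block_add [simp]: "block A B + block C D = block (A + C) (B + D)"
  by (simp add: gl22_eq_iff)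

lemma block_diff [simp]: "block A B - block C D = block (A - C) (B - D)"
  by (simp add: gl22_eq_iff)

lemma block_uminus: "- block A B = block (- A) (- B)"
  by (simp add: gl22_eq_iff)

lemma block_mscale [simp]: "mscale c (block A B) = block (mscale c A) (mscale c B)"
  by (simp add: gl22_eq_iff)

lemma sum_sum_type: "sum f (UNIV :: ('a::finite + 'b::finite) set) = (\<Sum>a\<in>UNIV. f (Inl a)) + (\<Sum>b\<in>UNIV. f (Inr b))"
  unfolding UNIV_sum by (subst sum.union_disjoint) (auto simp: sum.reindex)

lemma block_mult [simp]: "block A B ** block C D = block (A ** C + B ** D) (A ** D + B ** C)"
  by (simp add: gl22_eq_iff matrix_matrix_mult_def sum_sum_type)

lemma block_zero: "block 0 0 = 0"
  by (simp add: gl22_eq_iff)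

lemma mscale_0 [simp]: "mscale c 0 = 0" and mscale_minus1: "mscale (-1) A = - A" and mscale_1 [simp]: "mscale 1 A = A"
  by (simp_all add: vec_eq_iff)

lemma q2_part_0 [simp]: "X \<in> q2_part 0 \<longleftrightarrow> (\<exists>A. X = block A 0)"
  and q2_part_1 [simp]: "X \<in> q2_part 1 \<longleftrightarrow> (\<exists>B. X = block 0 B)"
  by (auto simp: q2_part_def)

lemma sbracket_even [simp]:
  "sbracket 0 q (block A 0) (block C D) = block (A ** C - C ** A) (A ** D - D ** A)"
  "sbracket p 0 (block C D) (block A 0) = block (C ** A - A ** C) (D ** A - A ** D)"
  by (simp_all add: sbracket_def ksign_def)

lemma sbracket_odd [simp]:
  "sbracket 1 1 (block 0 B) (block 0 D) = block (B ** D + D ** B) 0"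
  by (simp add: sbracket_def ksign_def mscale_minus1)

section \<open>The subsuperalgebra sq as the matrices with traceless odd block\<close>

definition odd_unit :: "'k::field gl22" where "odd_unit = block 0 (mat 1)"

text \<open>The trace condition on the odd block is solved for one entry, which makes it usable as a
  rewrite rule.\<close>

definition sq2_explicit :: "'k::field gl22 set" where
  "sq2_explicit = {block A B |A B. B $ 2 $ 2 = - B $ 1 $ 1}"

lemma gl2_eq_iff: "(A :: 'k::field gl2) = B \<longleftrightarrow> A$1$1 = B$1$1 \<and> A$1$2 = B$1$2 \<and> A$2$1 = B$2$1 \<and> A$2$2 = B$2$2"
  by (auto simp: vec_eq_iff forall_2)

lemma munit_nth [simp]: "munit i j $ a $ b = (if a = i \<and> b = j then 1 else 0)"
  by (simp add: munit_def)

lemma gl2_mult_nth: "((A :: 'k::field gl2) ** B) $ i $ j = A$i$1 * B$1$j + A$i$2 * B$2$j"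
  by (simp add: matrix_matrix_mult_def sum_2)

lemma mat_nth [simp]: "mat c $ i $ j = (if i = j then c else 0)"
  by (simp add: mat_def)

lemmas elements = H_def Hbar_def Ebar_def Fbar_def odd_unit_def

lemma odd_decomp:
  assumes "B$2$2 = - B$1$1"
  shows "block 0 B = mscale (B$1$1) (Hbar 1 - Hbar 2) + mscale (B$1$2) Ebar + mscale (B$2$1) Fbar"
  using assms by (simp add: elements gl2_eq_iff)

lemma q2_part_cases:
  assumes "X \<in> q2_part p"
  obtains A where "p = 0" "X = block A 0" | B where "p = 1" "X = block 0 B"
  using assms by (cases p) auto

text \<open>The bracket of an even and an odd element has a commutator of 2 by 2 matrices as its odd
  block, which is traceless; the bracket of two odd elements is even.\<close>

lemma sq2_explicit_subsuper: "subsuperalgebra (sq2_explicit :: 'k::field gl22 set)"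
  unfolding subsuperalgebra_def
proof (intro conjI ballI allI)
  show "sq2_explicit \<subseteq> (q2 :: 'k gl22 set)"
    by (auto simp: sq2_explicit_def q2_def)
  interpret module "mscale :: 'k \<Rightarrow> 'k gl22 \<Rightarrow> 'k gl22" by (rule module_mscale)
  show "subspace (sq2_explicit :: 'k gl22 set)"
  proof (rule subspaceI)
    show "0 \<in> (sq2_explicit :: 'k gl22 set)"
      unfolding sq2_explicit_def block_zero[symmetric] by force
    show "X + Y \<in> sq2_explicit" if "X \<in> sq2_explicit" "Y \<in> sq2_explicit" for X Y :: "'k gl22"
      using that unfolding sq2_explicit_def by force
    show "mscale c X \<in> sq2_explicit" if "X \<in> sq2_explicit" for c and X :: "'k gl22"
      using that unfolding sq2_explicit_def by force
  qed
next
  fix X :: "'k gl22" assume "X \<in> sq2_explicit"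
  then obtain A B where "X = block A 0 + block 0 B" "block A 0 \<in> sq2_explicit" "block 0 B \<in> sq2_explicit"
    unfolding sq2_explicit_def by force
  then show "\<exists>X0\<in>sq2_explicit \<inter> q2_part 0. \<exists>X1\<in>sq2_explicit \<inter> q2_part 1. X = X0 + X1"
    by (intro bexI[of _ "block A 0"] bexI[of _ "block 0 B"]) auto
next
  fix p q :: bit and X Y :: "'k gl22"
  assume "X \<in> sq2_explicit \<inter> q2_part p" "Y \<in> sq2_explicit \<inter> q2_part q"
  then show "sbracket p q X Y \<in> sq2_explicit"
    by (elim IntE q2_part_cases) (simp_all add: sq2_explicit_def gl2_mult_nth)
qed

text \<open>The even part and the three odd generators already span the explicit set linearly, so
  closure under sums and scalar multiples gives the second inclusion.\<close>

lemma sq2_eq: "sq2 = (sq2_explicit :: 'k::field gl22 set)"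
proof
  show "sq2 \<subseteq> (sq2_explicit :: 'k gl22 set)"
    unfolding sq2_def
    by (rule hull_minimal) (auto simp: sq2_explicit_subsuper, auto simp: sq2_explicit_def elements)
  show "sq2_explicit \<subseteq> (sq2 :: 'k gl22 set)"
  proof
    interpret module "mscale :: 'k \<Rightarrow> 'k gl22 \<Rightarrow> 'k gl22" by (rule module_mscale)
    fix X :: "'k gl22" assume "X \<in> sq2_explicit"
    then obtain A B where X: "X = block A 0 + block 0 B" and B: "B $ 2 $ 2 = - B $ 1 $ 1"
      unfolding sq2_explicit_def by force
    have "X \<in> S" if S: "subsuperalgebra S" "q2_part 0 \<union> {Ebar, Fbar, Hbar 1 - Hbar 2} \<subseteq> S" for S
    proof -
      have sub: "subspace S" using S(1) by (simp add: subsuperalgebra_def)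
      have "block A 0 \<in> S" using S(2) by auto
      moreover have "block 0 B \<in> S"
        unfolding odd_decomp[OF B] using S(2) by (auto intro!: subspace_add[OF sub] subspace_scale[OF sub])
      ultimately show ?thesis unfolding X by (rule subspace_add[OF sub])
    qed
    then show "X \<in> sq2" unfolding sq2_def hull_def by blast
  qed
qed

lemma subsuperalgebra_sq2: "subsuperalgebra sq2"
  by (simp add: sq2_eq sq2_explicit_subsuper)

lemma block_in_q2 [simp]: "block A B \<in> q2"
  by (auto simp: q2_def)

lemma block_in_sq2 [simp]: "block A B \<in> sq2 \<longleftrightarrow> B $ 2 $ 2 = - B $ 1 $ 1"
  by (auto simp: sq2_eq sq2_explicit_def)

lemma in_q2_iff: "X \<in> q2 \<longleftrightarrow> (\<exists>A B. X = block A B)"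
  by (auto simp: q2_def)

lemma in_sq2_iff: "X \<in> sq2 \<longleftrightarrow> (\<exists>A B. X = block A B \<and> B $ 2 $ 2 = - B $ 1 $ 1)"
  by (auto simp: sq2_eq sq2_explicit_def)

lemma subsuperalgebra_q2: "subsuperalgebra (q2 :: 'k::field gl22 set)"
  unfolding subsuperalgebra_def
proof (intro conjI ballI allI)
  interpret module "mscale :: 'k \<Rightarrow> 'k gl22 \<Rightarrow> 'k gl22" by (rule module_mscale)
  show "subspace (q2 :: 'k gl22 set)"
  proof (rule subspaceI)
    show "0 \<in> (q2 :: 'k gl22 set)"
      using block_in_q2[of 0 0] by (simp only: block_zero)
  qed (auto simp: in_q2_iff)
next
  fix X :: "'k gl22" assume "X \<in> q2"
  then obtain A B where "X = block A 0 + block 0 B"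
    unfolding in_q2_iff by force
  then show "\<exists>X0\<in>q2 \<inter> q2_part 0. \<exists>X1\<in>q2 \<inter> q2_part 1. X = X0 + X1"
    by (intro bexI[of _ "block A 0"] bexI[of _ "block 0 B"]) auto
next
  fix p q :: bit and X Y :: "'k gl22"
  assume "X \<in> q2 \<inter> q2_part p" "Y \<in> q2 \<inter> q2_part q"
  then show "sbracket p q X Y \<in> q2"
    by (elim IntE q2_part_cases) simp_all
qed simp

section \<open>Finite homogeneous generating sets of sq and q\<close>

abbreviation Epos :: "'k::field gl22" where "Epos \<equiv> block (munit 1 2) 0"
abbreviation Eneg :: "'k::field gl22" where "Eneg \<equiv> block (munit 2 1) 0"

lemma even_decomp:
  fixes A :: "'k::field_char_0 gl2"
  shows "block A 0 = mscale ((A$1$1 + A$2$2) / 2) (H 1 + H 2) + mscale ((A$1$1 - A$2$2) / 2) (H 1 - H 2)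
     + mscale (A$1$2) Epos + mscale (A$2$1) Eneg"
  by (simp add: elements gl2_eq_iff, simp add: diff_divide_distrib add_divide_distrib)

lemma odd_decomp_q2:
  fixes B :: "'k::field_char_0 gl2"
  shows "block 0 B = mscale ((B$1$1 - B$2$2) / 2) (Hbar 1 - Hbar 2) + mscale (B$1$2) Ebar + mscale (B$2$1) Fbar
    + mscale ((B$1$1 + B$2$2) / 2) odd_unit"
  by (simp add: elements gl2_eq_iff flip: add_divide_distrib diff_divide_distrib)

definition sq2_gens :: "bit \<Rightarrow> 'k::field gl22 set" where
  "sq2_gens p = (if p = 0 then {H 1 + H 2, H 1 - H 2, Epos, Eneg} else {Ebar, Fbar, Hbar 1 - Hbar 2})"

definition q2_gens :: "bit \<Rightarrow> 'k::field gl22 set" where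
  "q2_gens p = (if p = 0 then sq2_gens p else insert odd_unit (sq2_gens p))"

text \<open>Generation is meant linearly and parity by parity, so that stability under
  \<open>L\<close> reduces to stability under \<open>G\<close>. Finiteness serves to bound the
  dimension of simple supermodules.\<close>

definition generating :: "'k::field gl22 set \<Rightarrow> (bit \<Rightarrow> 'k gl22 set) \<Rightarrow> bool" where
  "generating L G \<longleftrightarrow> subsuperalgebra L \<and> (\<forall>p. finite (G p) \<and> G p \<subseteq> L \<inter> q2_part p \<and>
     L \<inter> q2_part p \<subseteq> module.span mscale (G p))"

lemma generating_sq2: "generating (sq2 :: 'k::field_char_0 gl22 set) sq2_gens"
proof -
  interpret module "mscale :: 'k::field_char_0 \<Rightarrow> 'k gl22 \<Rightarrow> 'k gl22" by (rule module_mscale)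
  have 0: "block A 0 \<in> span (sq2_gens 0)" for A :: "'k gl2"
    by (subst even_decomp, unfold sq2_gens_def, intro span_add span_scale span_base) auto
  have 1: "block 0 B \<in> span (sq2_gens 1)" if "B $ 2 $ 2 = - B $ 1 $ 1" for B :: "'k gl2"
    unfolding odd_decomp[OF that] sq2_gens_def by (intro span_add span_scale span_base) auto
  have "sq2_gens 0 \<subseteq> ((sq2 :: 'k gl22 set) \<inter> q2_part 0)" "sq2_gens 1 \<subseteq> ((sq2 :: 'k gl22 set) \<inter> q2_part 1)"
    by (simp_all add: sq2_gens_def elements)
  moreover have "(sq2 :: 'k gl22 set) \<inter> q2_part 0 \<subseteq> span (sq2_gens 0)" "(sq2 :: 'k gl22 set) \<inter> q2_part 1 \<subseteq> span (sq2_gens 1)"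
    using 0 1 by auto
  moreover have "finite (sq2_gens p :: 'k gl22 set)" for p
    by (simp add: sq2_gens_def)
  ultimately have "finite (sq2_gens p :: 'k gl22 set) \<and> sq2_gens p \<subseteq> (sq2 \<inter> q2_part p :: 'k gl22 set) \<and>
     sq2 \<inter> q2_part p \<subseteq> (span (sq2_gens p) :: 'k gl22 set)" for p
    by (cases p) simp_all
  then show ?thesis by (simp add: generating_def subsuperalgebra_sq2)
qed

lemma generating_q2: "generating (q2 :: 'k::field_char_0 gl22 set) q2_gens"
proof -
  interpret module "mscale :: 'k::field_char_0 \<Rightarrow> 'k gl22 \<Rightarrow> 'k gl22" by (rule module_mscale)
  have 0: "block A 0 \<in> span (q2_gens 0)" for A :: "'k gl2"
    by (subst even_decomp, unfold q2_gens_def sq2_gens_def, intro span_add span_scale span_base) auto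
  have 1: "block 0 B \<in> span (q2_gens 1)" for B :: "'k gl2"
    unfolding odd_decomp_q2 q2_gens_def sq2_gens_def by (intro span_add span_scale span_base) auto
  have "q2_gens 0 \<subseteq> ((q2 :: 'k gl22 set) \<inter> q2_part 0)" "q2_gens 1 \<subseteq> ((q2 :: 'k gl22 set) \<inter> q2_part 1)"
    by (simp_all add: q2_gens_def sq2_gens_def elements)
  moreover have "(q2 :: 'k gl22 set) \<inter> q2_part 0 \<subseteq> span (q2_gens 0)" "(q2 :: 'k gl22 set) \<inter> q2_part 1 \<subseteq> span (q2_gens 1)"
    using 0 1 by auto
  moreover have "finite (q2_gens p :: 'k gl22 set)" for p
    by (simp add: q2_gens_def sq2_gens_def)
  ultimately have "finite (q2_gens p :: 'k gl22 set) \<and> q2_gens p \<subseteq> (q2 \<inter> q2_part p :: 'k gl22 set) \<and>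
     q2 \<inter> q2_part p \<subseteq> (span (q2_gens p) :: 'k gl22 set)" for p
    by (cases p) simp_all
  then show ?thesis by (simp add: generating_def subsuperalgebra_q2)
qed

section \<open>Resolvents on spaces of countable dimension\<close>

text \<open>A countable spanning set has only countably many finite subsets, and the span of each of
  them contains finitely many members of an independent set.\<close>

lemma (in vector_space) independent_countable:
  assumes "independent B" "B \<subseteq> span S" "countable S"
  shows "countable B"
proof -
  have "\<exists>T. finite T \<and> T \<subseteq> S \<and> b \<in> span T" if "b \<in> B" for b
  proof -
    obtain T r where T: "finite T" "T \<subseteq> S" "b = (\<Sum>a\<in>T. r a *s a)"
      using \<open>b \<in> B\<close> assms(2) unfolding span_explicit by blast
    then have "b \<in> span T" by (auto intro: span_sum span_scale span_base)
    with T show ?thesis by blast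
  qed
  then have "B = (\<Union>T\<in>{T. finite T \<and> T \<subseteq> S}. B \<inter> span T)"
    by blast
  moreover have "finite (B \<inter> span T)" if "finite T" for T
    using independent_span_bound[OF that, of "B \<inter> span T"] independent_mono[OF assms(1), of "B \<inter> span T"] by blast
  then have "countable (\<Union>T\<in>{T. finite T \<and> T \<subseteq> S}. B \<inter> span T)"
    by (intro countable_UN countable_Collect_finite_subset assms(3)) (simp add: countable_finite)
  ultimately show ?thesis by simp
qed

text \<open>The vectors \<open>(P - a)\<^sup>-\<^sup>1 v\<close>, for \<open>a\<close> in the field, are linearly independent by partial fractions.\<close>

lemma resolvent_uncountable:
  fixes scl :: "'k::alg_closed_field \<Rightarrow> 'v::ab_group_add \<Rightarrow> 'v"
  assumes "vector_space scl" and unc: "uncountable (UNIV :: 'k set)"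
    and U: "module.subspace scl U" "U \<subseteq> module.span scl S" "countable S"
    and P: "linear_on_carr scl U P" "P ` U \<subseteq> U"
    and inj: "\<And>a u. u \<in> U \<Longrightarrow> P u = scl a u \<Longrightarrow> u = 0"
    and surj: "\<And>a w. w \<in> U \<Longrightarrow> \<exists>u\<in>U. P u - scl a u = w"
    and v: "v \<in> U" 
  shows "v = 0"
proof (rule ccontr)
  assume v0: "v \<noteq> 0"
  interpret vector_space scl by fact
  have PU: "P u \<in> U" if "u \<in> U" for u using that P by blast
  have P0: "P 0 = 0" and Padd: "\<And>u w. u \<in> U \<Longrightarrow> w \<in> U \<Longrightarrow> P (u + w) = P u + P w"
    and Pscale: "\<And>c u. u \<in> U \<Longrightarrow> P (scl c u) = scl c (P u)"
    using P(1) subspace_0[OF U(1)] scale_zero_left[of "P 0"] scale_zero_left[of 0]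
    unfolding linear_on_carr_def by metis+
  note Us = subspace_0[OF U(1)] subspace_add[OF U(1)] subspace_scale[OF U(1)] subspace_diff[OF U(1)] PU v
  \<comment> \<open>\<open>pact p\<close> is the vector \<open>p(P) v\<close>, computed by Horner's
    scheme.\<close>
  define pact where "pact = (\<lambda>p. fold_coeffs (\<lambda>a w. scl a v + P w) p 0)"
  have pact_0 [simp]: "pact 0 = 0" by (simp add: pact_def)
  have pact_pCons [simp]: "pact (pCons a p) = scl a v + P (pact p)" for a p
    by (cases "p = 0"; cases "a = 0")
      (simp_all add: pact_def P0 fold_coeffs_pCons_coeff_not_0_eq fold_coeffs_pCons_not_0_0_eq)
  have pactU: "pact p \<in> U" for p
    by (induction p) (simp_all add: Us)
  have pact_add: "pact (p + q) = pact p + pact q" for p q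
  proof (induction p arbitrary: q)
    case (pCons a p)
    obtain b q' where "q = pCons b q'" by (cases q)
    then show ?case using pCons.IH[of q'] by (simp add: Padd pactU scale_left_distrib algebra_simps)
  qed simp
  have pact_smult: "pact (smult c p) = scl c (pact p)" for c p
    by (induction p) (simp_all add: Pscale pactU scale_right_distrib)
  have pact_lin: "pact ([:-r, 1:] * p) = P (pact p) - scl r (pact p)" for r p
  proof -
    have "[:-r, 1:] * p = smult (- r) p + pCons 0 p" by simp
    then show ?thesis by (simp only: pact_add pact_smult pact_pCons) simp
  qed
  \<comment> \<open>A nonconstant polynomial has a root \<open>r\<close>, and injectivity of
    \<open>P - r\<close> lets the corresponding linear factor be cancelled.\<close>
  have pact_eq_0: "p = 0" if "pact p = 0" for p
    using that
  proof (induction "degree p" arbitrary: p rule: less_induct)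
    case less
    show ?case
    proof (cases "degree p = 0")
      case True
      then obtain a where "p = [:a:]" by (metis degree_eq_zeroE)
      then show ?thesis using less.prems v0 by (simp add: P0)
    next
      case False
      then obtain r where "poly p r = 0" using alg_closed_imp_poly_has_root by blast
      then obtain q where q: "p = [:-r, 1:] * q" using poly_eq_0_iff_dvd by blast
      have "pact q = 0"
        using less.prems inj[OF pactU, of q r] unfolding q pact_lin by simp
      moreover have "degree q < degree p"
        using False degree_mult_eq[of "[:-r, 1:]" q] unfolding q
        by (cases "q = 0") (simp_all del: mult_pCons_left)
      ultimately have "q = 0" using less.hyps by blast
      then show ?thesis by (simp add: q)
    qed
  qed
  \<comment> \<open>\<open>u a\<close> is the resolvent vector
    \<open>(P - a)^(-1) v\<close>.\<close>
  obtain u where u: "\<And>a. u a \<in> U" "\<And>a. P (u a) - scl a (u a) = v"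
    using surj[OF v] by metis
  have Pu: "P (u a) = v + scl a (u a)" for a using u(2)[of a] by (simp add: algebra_simps)
  \<comment> \<open>The polynomial summand makes the induction work: applying \<open>P - b\<close>
    turns the term at \<open>b\<close> into a multiple of \<open>v\<close>, which is absorbed into
    the polynomial, and multiplies each coefficient \<open>k a\<close> by \<open>a - b\<close>, up
    to further multiples of \<open>v\<close>.\<close>
  have indep: "\<forall>a\<in>F. k a = 0" if "finite F" "pact p + (\<Sum>a\<in>F. scl (k a) (u a)) = 0" for F p k
    using that
  proof (induction F arbitrary: p k)
    case (insert b F)
    let ?s = "\<Sum>a\<in>F. scl (k a) (u a)"
    let ?l = "\<lambda>w. P w - scl b w"
    have ladd: "?l (w + w') = ?l w + ?l w'" if "w \<in> U" "w' \<in> U" for w w'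
      using that by (simp add: Padd scale_right_distrib)
    have lsum: "(\<Sum>a\<in>A. scl (k a) (u a)) \<in> U \<and>
      ?l (\<Sum>a\<in>A. scl (k a) (u a)) = scl (\<Sum>a\<in>A. k a) v + (\<Sum>a\<in>A. scl (k a * (a - b)) (u a))" if "finite A" for A
      using that
    proof (induction A)
      case (insert a A)
      have "?l (scl (k a) (u a)) = scl (k a) v + scl (k a * (a - b)) (u a)"
        by (simp add: Pscale u Pu algebra_simps)
      then show ?case using insert
        by (simp add: ladd Us u scale_left_distrib add_ac del: diff_add_eq)
    qed (simp add: P0 Us)
    have const: "pact [:c:] = scl c v" for c by (simp add: P0)
    have "?l (pact p + (\<Sum>a\<in>insert b F. scl (k a) (u a))) = 0"
      unfolding insert.prems by (simp add: P0)
    then have "?l (pact p) + (scl (\<Sum>a\<in>insert b F. k a) v + (\<Sum>a\<in>insert b F. scl (k a * (a - b)) (u a))) = 0"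
      using lsum[of "insert b F"] insert.hyps by (simp add: ladd pactU del: sum.insert)
    then have "pact ([:-b, 1:] * p + [:\<Sum>a\<in>insert b F. k a:]) + (\<Sum>a\<in>F. scl (k a * (a - b)) (u a)) = 0"
      unfolding pact_add const pact_lin using insert.hyps by (simp add: algebra_simps)
    from insert.IH[OF this] have kF: "\<forall>a\<in>F. k a = 0" using insert.hyps by auto
    then have "sum k (insert b F) = k b" "pact p + scl (k b) (u b) = 0"
      using insert.hyps insert.prems by simp_all
    then have "?l (pact p) + scl (k b) v = 0"
      using ladd[of "pact p" "scl (k b) (u b)"] by (simp add: pactU Us u P0 Pscale Pu algebra_simps)
    then have "pact ([:-b, 1:] * p + [:k b:]) = 0"
      unfolding pact_add const pact_lin .
    \<comment> \<open>The first summand vanishes at \<open>b\<close>, so evaluation there isolates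
      \<open>k b\<close>.\<close>
    then have "poly ([:-b, 1:] * p + [:k b:]) b = 0" using pact_eq_0 by (metis poly_0)
    then show ?case using kF by simp
  qed simp
  have "inj u"
  proof (rule injI)
    fix a b assume "u a = u b"
    then have "scl (a - b) (u a) = 0" using u(2)[of a] u(2)[of b] by (simp add: algebra_simps)
    moreover have "u a \<noteq> 0" using u(2)[of a] v0 by (auto simp: P0)
    ultimately show "a = b" by simp
  qed
  have "independent (range u)"
    unfolding independent_explicit_module
  proof (intro allI impI)
    fix t f w assume t: "finite t" "t \<subseteq> range u" "(\<Sum>v\<in>t. scl (f v) v) = 0" "w \<in> t"
    then obtain F where F: "t = u ` F" "finite F" by (meson finite_subset_image)
    have "pact 0 + (\<Sum>a\<in>F. scl (f (u a)) (u a)) = 0"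
      using t(3) F \<open>inj u\<close> by (simp add: sum.reindex inj_on_def inj_def)
    from indep[OF F(2) this] show "f w = 0" using t(4) F by auto
  qed
  moreover have "range u \<subseteq> span S" using u(1) U(2) by blast
  ultimately have "countable (range u)" using U(3) by (rule independent_countable)
  then show False using unc \<open>inj u\<close> countable_image_inj_eq by blast
qed

section \<open>Supermodules\<close>

locale smod = vector_space scl
  for scl :: "'k::field \<Rightarrow> 'v::ab_group_add \<Rightarrow> 'v" +
  fixes L :: "'k gl22 set" and V :: "('k, 'v) supermod"
  assumes subsuper: "subsuperalgebra L" and supermodule: "supermodule scl L V"
begin

lemma comp_subspace: "subspace (comp V i)"
  and comp_inter: "comp V 0 \<inter> comp V 1 = {0}"
  and act_linear: "X \<in> L \<Longrightarrow> linear_on_carr scl (carr V) (act V X)"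
  and act_add_left: "X \<in> L \<Longrightarrow> Y \<in> L \<Longrightarrow> v \<in> carr V \<Longrightarrow> act V (X + Y) v = act V X v + act V Y v"
  and act_mscale: "X \<in> L \<Longrightarrow> v \<in> carr V \<Longrightarrow> act V (mscale c X) v = scl c (act V X v)"
  and act_comp: "X \<in> L \<Longrightarrow> X \<in> q2_part p \<Longrightarrow> v \<in> comp V i \<Longrightarrow> act V X v \<in> comp V (p + i)"
  and act_sbracket: "X \<in> L \<Longrightarrow> X \<in> q2_part p \<Longrightarrow> Y \<in> L \<Longrightarrow> Y \<in> q2_part q \<Longrightarrow> v \<in> carr V \<Longrightarrow>
    act V (sbracket p q X Y) v = act V X (act V Y v) - scl (ksign p q) (act V Y (act V X v))"
  using supermodule by (simp_all add: supermodule_def)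

lemma act_add: "X \<in> L \<Longrightarrow> u \<in> carr V \<Longrightarrow> v \<in> carr V \<Longrightarrow> act V X (u + v) = act V X u + act V X v"
  and act_scl: "X \<in> L \<Longrightarrow> v \<in> carr V \<Longrightarrow> act V X (scl c v) = scl c (act V X v)"
  using act_linear by (simp_all add: linear_on_carr_def)

lemma comp_0: "0 \<in> comp V i"
  by (rule subspace_0[OF comp_subspace])

lemma comp_carr: "v \<in> comp V i \<Longrightarrow> v \<in> carr V"
  using comp_0[of 0] comp_0[of 1] unfolding carr_def by (cases i) force+

lemma carrE:
  assumes "v \<in> carr V" obtains v0 v1 where "v0 \<in> comp V 0" "v1 \<in> comp V 1" "v = v0 + v1"
  using assms by (auto simp: carr_def)

lemma carr_subspace: "subspace (carr V)"
proof -
  have "carr V = {x + y |x y. x \<in> comp V 0 \<and> y \<in> comp V 1}" by (simp add: carr_def)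
  then show ?thesis using subspace_sums[OF comp_subspace[of 0] comp_subspace[of 1]] by simp
qed

lemma L_decomp: "X \<in> L \<Longrightarrow> \<exists>X0 \<in> L \<inter> q2_part 0. \<exists>X1 \<in> L \<inter> q2_part 1. X = X0 + X1"
  and L_subspace: "module.subspace mscale L"
  and L_sbracket: "X \<in> L \<Longrightarrow> X \<in> q2_part p \<Longrightarrow> Y \<in> L \<Longrightarrow> Y \<in> q2_part q \<Longrightarrow> sbracket p q X Y \<in> L"
  using subsuper by (simp_all add: subsuperalgebra_def)

lemma act_carr: assumes "X \<in> L" "v \<in> carr V" shows "act V X v \<in> carr V"
proof -
  obtain X0 X1 where X: "X0 \<in> L" "X0 \<in> q2_part 0" "X1 \<in> L" "X1 \<in> q2_part 1" "X = X0 + X1"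
    using L_decomp[OF assms(1)] by blast
  obtain v0 v1 where v: "v0 \<in> comp V 0" "v1 \<in> comp V 1" "v = v0 + v1"
    using carrE[OF assms(2)] .
  have *: "act V Y v \<in> carr V" if "Y \<in> L" "Y \<in> q2_part p" for Y p
    unfolding v(3) using that v
    by (simp add: act_add comp_carr subspace_add[OF carr_subspace] comp_carr[OF act_comp])
  show ?thesis
    using X *[of X0 0] *[of X1 1] assms(2) by (simp add: act_add_left subspace_add[OF carr_subspace])
qed

lemma carr_unique:
  assumes "u0 \<in> comp V 0" "u1 \<in> comp V 1" "v0 \<in> comp V 0" "v1 \<in> comp V 1" "u0 + u1 = v0 + v1"
  shows "u0 = v0 \<and> u1 = v1"
proof -
  have "u0 - v0 = v1 - u1" using assms(5) by (simp add: algebra_simps)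
  moreover have "u0 - v0 \<in> comp V 0" "v1 - u1 \<in> comp V 1"
    using assms by (auto intro: subspace_diff[OF comp_subspace])
  ultimately have "v1 - u1 = 0" by (metis IntI comp_inter singletonD)
  then show ?thesis using assms(5) by simp
qed

section \<open>Stability under generators and countable dimension\<close>

lemma subsupermodule_generating:
  assumes G: "generating L G" and N: "\<And>i. subspace (N i)" "\<And>i. N i \<subseteq> comp V i"
    and GN: "\<And>p i X v. X \<in> G p \<Longrightarrow> v \<in> N i \<Longrightarrow> act V X v \<in> N (p + i)"
  shows "subsupermodule scl L V N"
  unfolding subsupermodule_def
proof (intro conjI allI ballI)
  interpret m: module mscale by (rule module_mscale)
  fix p i X v assume X: "X \<in> L \<inter> q2_part p" and v: "v \<in> N i"
  have "v \<in> carr V" using v N(2) comp_carr by blast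
  have "X \<in> m.span (G p)" using X G by (auto simp: generating_def)
  \<comment> \<open>Membership in \<open>L\<close> is carried through the induction because
    additivity of the action is given only there. That 0 acts as zero is not an axiom and comes from
    scaling by 0.\<close>
  then have "X \<in> L \<and> act V X v \<in> N (p + i)"
  proof (induction rule: m.span_induct_alt)
    case base
    have "act V (mscale 0 0) v = scl 0 (act V 0 v)"
      by (intro act_mscale m.subspace_0[OF L_subspace]) fact
    then show ?case by (simp add: m.subspace_0[OF L_subspace] subspace_0[OF N(1)])
  next
    case (step c Y X)
    have "Y \<in> L" using step G by (auto simp: generating_def)
    then show ?case using step GN[OF step(1) v] \<open>v \<in> carr V\<close>
      by (simp add: act_add_left act_mscale m.subspace_add[OF L_subspace] m.subspace_scale[OF L_subspace]
        subspace_add[OF N(1)] subspace_scale[OF N(1)])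
  qed
  then show "act V X v \<in> N (p + i)" by simp
qed (use N in auto)

text \<open>Words in the finitely many generators, applied to one nonzero homogeneous vector, form a
  countable set. Its span is a nonzero graded subsupermodule, hence everything.\<close>

lemma countable_generation:
  assumes G: "generating L G" and simple: "simple_supermodule scl L V"
  shows "\<exists>S. countable S \<and> carr V \<subseteq> span S"
proof -
  have "comp V \<noteq> (\<lambda>_. {0})" using simple by (simp add: simple_supermodule_def)
  then obtain i0 where "comp V i0 \<noteq> {0}" by fastforce
  then obtain v where v: "v \<in> comp V i0" "v \<noteq> 0" using comp_0 by blast
  have GL: "X \<in> L" "X \<in> q2_part p" if "X \<in> G p" for X p
    using G that unfolding generating_def by blast+
  have "finite (G p)" for p using G by (simp add: generating_def)
  \<comment> \<open>Each vector is stored together with its parity, since the vector 0 lies in both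
    components. \<open>W n\<close> consists of the results of words of length
    \<open>n\<close>.\<close>
  define next_set where "next_set = (\<lambda>T. \<Union>p\<in>{0, 1}. \<Union>X\<in>G p. (\<lambda>(j, u). (p + j, act V X u)) ` T)"
  define W where "W n = (next_set ^^ n) {(i0, v)}" for n
  have finite: "finite (W n)" for n
    unfolding W_def by (induction n) (use \<open>\<And>p. finite (G p)\<close> in \<open>simp_all add: next_set_def\<close>)
  have WV: "u \<in> comp V j" if "(j, u) \<in> W n" for n j u
    using that unfolding W_def
  proof (induction n arbitrary: j u)
    case (Suc n)
    then obtain p X i w where "X \<in> G p" "(i, w) \<in> (next_set ^^ n) {(i0, v)}" "j = p + i" "u = act V X w"
      by (auto simp: next_set_def)
    with Suc.IH show ?case using GL by (blast intro: act_comp)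
  qed (use v in simp)
  have next_W: "(p + j, act V X u) \<in> W (Suc n)" if "(j, u) \<in> W n" "X \<in> G p" for p j X u n
    using that unfolding W_def by (cases p) (simp_all add: next_set_def, force+)
  define N where "N j = span {u. \<exists>n. (j, u) \<in> W n}" for j
  have N: "subspace (N i)" "N i \<subseteq> comp V i" for i
    unfolding N_def by (rule subspace_span, rule span_minimal) (use WV comp_subspace in auto)
  have "subsupermodule scl L V N"
  proof (rule subsupermodule_generating[OF G N])
    fix p i X w assume X: "X \<in> G p" and w: "w \<in> N i"
    note XL = GL[OF X]
    from w have "w \<in> carr V \<and> act V X w \<in> N (p + i)" unfolding N_def
    proof (induction rule: span_induct_alt)
      case base
      have "act V X (scl 0 0) = scl 0 (act V X 0)"
        by (rule act_scl[OF XL(1) subspace_0[OF carr_subspace]])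
      then show ?case by (simp add: span_zero subspace_0[OF carr_subspace])
    next
      case (step c u y)
      then obtain n where n: "(i, u) \<in> W n" by auto
      have "u \<in> carr V" using WV[OF n] comp_carr by blast
      moreover have "act V X u \<in> span {u. \<exists>n. (p + i, u) \<in> W n}"
        using next_W[OF n X] by (intro span_base) blast
      ultimately show ?case using step(2) XL
        by (simp add: act_add act_scl subspace_add[OF carr_subspace] subspace_scale[OF carr_subspace] span_add span_scale)
    qed
    then show "act V X w \<in> N (p + i)" by simp
  qed
  moreover have "v \<in> N i0"
    unfolding N_def by (intro span_base CollectI exI[of _ 0]) (simp add: W_def)
  ultimately have "N = comp V"
    using simple v unfolding simple_supermodule_def by (metis singletonD)
  moreover have "N j \<subseteq> span (\<Union>n. snd ` W n)" for j
    unfolding N_def by (rule span_mono) force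
  ultimately have "carr V \<subseteq> span (\<Union>n. snd ` W n)"
    unfolding carr_def by (auto intro!: span_add)
  moreover have "countable (\<Union>n. snd ` W n)"
    using finite by (simp add: countable_finite)
  ultimately show ?thesis by blast
qed

end

section \<open>Schur's lemma\<close>

text \<open>Suppose that \<open>P\<close> is not a scalar. The kernel of each \<open>P - a\<close>
  is a graded subsupermodule other than \<open>V\<close>, hence zero; the image is a nonzero one,
  hence everything. The resolvents at a nonzero vector would then be an uncountable independent
  family in a space of countable dimension.\<close>

lemma schur:
  fixes scl :: "'k::alg_closed_field \<Rightarrow> 'v::ab_group_add \<Rightarrow> 'v"
  assumes "smod scl L V" and unc: "uncountable (UNIV :: 'k set)" and G: "generating L G"
    and simple: "simple_supermodule scl L V"
    and P: "linear_on_carr scl (carr V) P" "\<And>i v. v \<in> comp V i \<Longrightarrow> P v \<in> comp V i"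
    and comm: "\<And>p X v. X \<in> G p \<Longrightarrow> v \<in> carr V \<Longrightarrow> P (act V X v) = act V X (P v)"
  shows "\<exists>a. \<forall>v\<in>carr V. P v = scl a v"
proof (rule ccontr)
  assume not_scalar: "\<nexists>a. \<forall>v\<in>carr V. P v = scl a v"
  interpret smod scl L V by fact
  have GL: "X \<in> L" "X \<in> q2_part p" if "X \<in> G p" for X p
    using G that unfolding generating_def by blast+
  note lin = P(1)[unfolded linear_on_carr_def]
  have Padd: "P (u + v) = P u + P v" if "u \<in> carr V" "v \<in> carr V" for u v using lin that by blast
  have Pscl: "P (scl c v) = scl c (P v)" if "v \<in> carr V" for c v using lin that by blast
  have P0: "P 0 = 0" using Pscl[OF comp_carr[OF comp_0], of 0] by simp
  note cs = subspace_0[OF comp_subspace] subspace_add[OF comp_subspace] subspace_scale[OF comp_subspace]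
    subspace_diff[OF comp_subspace]
  have simpleD: "N = (\<lambda>_. {0}) \<or> N = comp V" if "subsupermodule scl L V N" for N
    using simple that by (simp add: simple_supermodule_def)
  have inj_comp: "v = 0" if "v \<in> comp V i" "P v = scl a v" for a v i
  proof -
    let ?N = "\<lambda>i. {v \<in> comp V i. P v = scl a v}"
    have "subsupermodule scl L V ?N"
    proof (rule subsupermodule_generating[OF G])
      show "subspace (?N i)" for i
        by (rule subspaceI) (auto simp: cs P0 Padd Pscl comp_carr scale_right_distrib mult.commute)
      show "act V X v \<in> ?N (p + i)" if X: "X \<in> G p" and v: "v \<in> ?N i" for p i X v
      proof (intro CollectI conjI)
        show "act V X v \<in> comp V (p + i)" using act_comp[OF GL[OF X]] v by blast
        have "v \<in> carr V" "P v = scl a v" using v comp_carr by blast+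
        then show "P (act V X v) = scl a (act V X v)"
          by (simp add: comm[OF X] act_scl[OF GL(1)[OF X]])
      qed
    qed auto
    from simpleD[OF this] show ?thesis
    proof
      assume "?N = comp V"
      then have *: "P v = scl a v" if "v \<in> comp V i" for i v
        using that by (metis (mono_tags, lifting) mem_Collect_eq)
      have "P v = scl a v" if "v \<in> carr V" for v
        using carrE[OF that] by (metis * Padd comp_carr scale_right_distrib)
      then show ?thesis using not_scalar by blast
    next
      assume "?N = (\<lambda>_. {0})"
      then have "?N i = {0}" by (rule fun_cong)
      with that show ?thesis by blast
    qed
  qed
  have inj: "v = 0" if v: "v \<in> carr V" "P v = scl a v" for a v
  proof -
    obtain v0 v1 where v01: "v0 \<in> comp V 0" "v1 \<in> comp V 1" "v = v0 + v1" using carrE[OF v(1)] .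
    then have "P v0 + P v1 = scl a v0 + scl a v1"
      using v(2) by (simp add: Padd comp_carr scale_right_distrib)
    then have "P v0 = scl a v0 \<and> P v1 = scl a v1"
      by (intro carr_unique) (simp_all add: P v01 cs)
    then have "v0 = 0" "v1 = 0" using v01 inj_comp by blast+
    then show ?thesis using v01 by simp
  qed
  obtain i0 where "comp V i0 \<noteq> {0}" using simple by (fastforce simp: simple_supermodule_def)
  then obtain v where v: "v \<in> comp V i0" "v \<noteq> 0" using comp_0 by blast
  have surj_comp: "\<exists>u\<in>comp V i. P u - scl a u = w" if w: "w \<in> comp V i" for a w i
  proof -
    let ?N = "\<lambda>i. (\<lambda>u. P u - scl a u) ` comp V i"
    have "subsupermodule scl L V ?N"
    proof (rule subsupermodule_generating[OF G])
      show "subspace (?N i)" for i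
      proof (rule subspaceI)
        show "0 \<in> ?N i" by (rule image_eqI[of _ _ 0]) (simp_all add: P0 cs)
        show "x + y \<in> ?N i" if xy: "x \<in> ?N i" "y \<in> ?N i" for x y
        proof -
          obtain u u' where "x = P u - scl a u" "y = P u' - scl a u'" "u \<in> comp V i" "u' \<in> comp V i" using xy by blast
          then show ?thesis
            by (intro image_eqI[of _ _ "u + u'"]) (simp_all add: Padd comp_carr cs scale_right_distrib)
        qed
        show "scl c x \<in> ?N i" if x: "x \<in> ?N i" for c x
        proof -
          obtain u where "x = P u - scl a u" "u \<in> comp V i" using x by blast
          then show ?thesis
            by (intro image_eqI[of _ _ "scl c u"]) (simp_all add: Pscl comp_carr cs scale_right_diff_distrib mult.commute)
        qed
      qed
      show "?N i \<subseteq> comp V i" for i using P by (auto simp: cs)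
      show "act V X v \<in> ?N (p + i)" if X: "X \<in> G p" and v: "v \<in> ?N i" for p i X v
      proof -
        obtain u where u: "v = P u - scl a u" "u \<in> comp V i" using v by blast
        have uv: "u \<in> carr V" "v \<in> carr V" using u P(2) by (auto intro!: comp_carr[of _ i] simp: cs)
        have "P u = v + scl a u" using u by simp
        then have "P (act V X u) = act V X (v + scl a u)" using comm[OF X uv(1)] by simp
        also have "\<dots> = act V X v + scl a (act V X u)"
          using uv GL(1)[OF X] by (simp add: act_add act_scl subspace_scale[OF carr_subspace])
        finally have "P (act V X u) = act V X v + scl a (act V X u)" .
        then show ?thesis using act_comp[OF GL[OF X] u(2)] by (intro image_eqI[of _ _ "act V X u"]) simp_all
      qed
    qed
    from simpleD[OF this] show ?thesis
    proof
      \<comment> \<open>A zero image would make the nonzero vector \<open>v\<close> an eigenvector,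
        against \<open>inj_comp\<close>.\<close>
      assume "?N = (\<lambda>_. {0})"
      then have "?N i0 = {0}" by (rule fun_cong)
      moreover have "P v - scl a v \<in> ?N i0" using v by blast
      ultimately have "P v = scl a v" by simp
      then show ?thesis using inj_comp v by blast
    next
      assume "?N = comp V"
      then have "?N i = comp V i" by (rule fun_cong)
      then have "w \<in> ?N i" using w by (simp only:)
      then show ?thesis by blast
    qed
  qed
  obtain S where S: "countable S" "carr V \<subseteq> span S" using countable_generation[OF G simple] by blast
  have "v = 0"
  proof (rule resolvent_uncountable[OF _ unc carr_subspace S(2,1) P(1) _ inj _ comp_carr[OF v(1)]])
    show "vector_space scl" by unfold_locales
    show "P ` carr V \<subseteq> carr V"
    proof
      fix w assume "w \<in> P ` carr V"
      then obtain v0 v1 where "v0 \<in> comp V 0" "v1 \<in> comp V 1" "w = P (v0 + v1)" by (auto elim: carrE)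
      then show "w \<in> carr V" using P(2) by (simp add: Padd comp_carr subspace_add[OF carr_subspace] comp_carr[OF P(2)])
    qed
    show "\<exists>u\<in>carr V. P u - scl a u = w" if w_carr: "w \<in> carr V" for a w
    proof -
      obtain w0 w1 where w: "w0 \<in> comp V 0" "w1 \<in> comp V 1" "w = w0 + w1" using carrE[OF w_carr] .
      obtain u0 u1 where "u0 \<in> comp V 0" "u1 \<in> comp V 1" "P u0 - scl a u0 = w0" "P u1 - scl a u1 = w1"
        using surj_comp w by meson
      then show ?thesis using w
        by (intro bexI[of _ "u0 + u1"])
          (auto simp: Padd comp_carr scale_right_distrib intro: subspace_add[OF carr_subspace])
    qed
  qed
  then show False using v by simp
qed

section \<open>Supermodules as rings of endomorphisms\<close>

definition (in vector_space) sc :: "'a \<Rightarrow> 'b aend" where "sc c = Aend (scale c)"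

lemma (in vector_space) ap_sc [simp]: "ap (sc c) v = scale c v"
  by (simp add: sc_def Aend_inverse scale_right_distrib)

lemma (in vector_space) sc_simps [simp]:
  "sc 0 = 0" "sc 1 * a = a" "sc (- c) = - sc c" "sc c * sc d = sc (c * d)" "sc (c + d) = sc c + sc d"
  by (rule aend_eqI; simp add: scale_left_distrib)+

context smod
begin

text \<open>Operators on the carrier are extended to the ambient space by composition with a projection, so
  that they can be calculated with in a ring; the identity of the carrier becomes an idempotent.\<close>

definition is_proj :: "(bit \<Rightarrow> 'v aend) \<Rightarrow> bool" where
  "is_proj p \<longleftrightarrow> (\<forall>i. (\<forall>v. ap (p i) v \<in> comp V i) \<and> (\<forall>v\<in>comp V i. ap (p i) v = v) \<and>
     (\<forall>v\<in>comp V (i + 1). ap (p i) v = 0) \<and> (\<forall>c v. ap (p i) (scl c v) = scl c (ap (p i) v)))"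

lemma ex_proj: "\<exists>p. is_proj p"
proof -
  interpret vector_space_pair scl scl by unfold_locales
  have "Vector_Spaces.linear scl scl id"
    by (rule linear_id)
  \<comment> \<open>A linear left inverse of the identity on the carrier is a linear retraction
    \<open>g\<close> of the ambient space onto it. The projections are the two homogeneous
    components of \<open>g w\<close>, and their linearity follows from uniqueness of the
    decomposition.\<close>
  from linear_exists_left_inverse_on[OF this carr_subspace]
  obtain g where g: "range g \<subseteq> carr V" "Vector_Spaces.linear scl scl g" "\<And>v. v \<in> carr V \<Longrightarrow> g v = v"
    by auto
  interpret g: Vector_Spaces.linear scl scl g by fact
  have "\<exists>v0 v1. v0 \<in> comp V 0 \<and> v1 \<in> comp V 1 \<and> g w = v0 + v1" for w
  proof -
    have "g w \<in> carr V" using g(1) by blast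
    then show ?thesis by (metis carrE)
  qed
  then obtain d0 d1 where d: "\<And>w. d0 w \<in> comp V 0" "\<And>w. d1 w \<in> comp V 1" "\<And>w. g w = d0 w + d1 w"
    by metis
  have du: "d0 w = v0 \<and> d1 w = v1" if "v0 \<in> comp V 0" "v1 \<in> comp V 1" "g w = v0 + v1" for w v0 v1
    using that d by (intro carr_unique) simp_all
  note cs = subspace_0[OF comp_subspace] subspace_add[OF comp_subspace] subspace_scale[OF comp_subspace]
  have dadd: "d0 (u + w) = d0 u + d0 w \<and> d1 (u + w) = d1 u + d1 w" for u w
    by (rule du) (simp_all add: cs d(1,2) g.add, simp add: d(3))
  have dscl: "d0 (scl c u) = scl c (d0 u) \<and> d1 (scl c u) = scl c (d1 u)" for c u
    by (rule du) (simp_all add: cs d(1,2) g.scale, simp add: d(3) scale_right_distrib)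
  have d_0: "d0 v = v \<and> d1 v = 0" if "v \<in> comp V 0" for v
    by (rule du) (use that in \<open>simp_all add: cs g(3) comp_carr\<close>)
  have d_1: "d0 v = 0 \<and> d1 v = v" if "v \<in> comp V 1" for v
    by (rule du) (use that in \<open>simp_all add: cs g(3) comp_carr\<close>)
  define p where "p i = Aend (if i = (0::bit) then d0 else d1)" for i
  have p: "ap (p 0) = d0" "ap (p 1) = d1"
    by (simp_all add: p_def Aend_inverse dadd)
  have "(\<forall>v. ap (p i) v \<in> comp V i) \<and> (\<forall>v\<in>comp V i. ap (p i) v = v) \<and>
     (\<forall>v\<in>comp V (i + 1). ap (p i) v = 0) \<and> (\<forall>c v. ap (p i) (scl c v) = scl c (ap (p i) v))" for i
    by (cases i) (simp_all add: p d d_0 d_1 dscl)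
  then show ?thesis unfolding is_proj_def by blast
qed

definition pr :: "bit \<Rightarrow> 'v aend" where "pr = (SOME p. is_proj p)"

lemma is_proj_pr: "is_proj pr"
  unfolding pr_def by (rule someI_ex[OF ex_proj])

lemma pr_comp: "ap (pr i) v \<in> comp V i"
  and pr_id: "v \<in> comp V i \<Longrightarrow> ap (pr i) v = v"
  and pr_other: "v \<in> comp V (i + 1) \<Longrightarrow> ap (pr i) v = 0"
  and pr_scl [simp]: "ap (pr i) (scl c v) = scl c (ap (pr i) v)"
  using is_proj_pr unfolding is_proj_def by blast+

definition unit_op :: "'v aend" where "unit_op = pr 0 + pr 1"
definition par_op :: "'v aend" where "par_op = pr 0 - pr 1"

lemma pr_simps [simp]: "pr i * pr i = pr i" "pr 0 * pr 1 = 0" "pr 1 * pr 0 = 0" "pr i * sc c = sc c * pr i"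
  by (rule aend_eqI; use pr_id pr_comp pr_other[of _ 0] pr_other[of _ 1] in simp)+

lemma unit_simps [simp]: "unit_op * unit_op = unit_op" "unit_op * par_op = par_op" "par_op * unit_op = par_op"
  "par_op * par_op = unit_op" "unit_op * sc c = sc c * unit_op" "par_op * sc c = sc c * par_op"
  by (simp_all add: unit_op_def par_op_def algebra_simps)

lemma ap_unit_scl [simp]: "ap unit_op (scl c v) = scl c (ap unit_op v)"
  by (simp add: unit_op_def scale_right_distrib)

lemma unit_carr: "ap unit_op v \<in> carr V"
  by (simp add: unit_op_def subspace_add[OF carr_subspace] comp_carr[OF pr_comp])

lemma unit_id: "v \<in> carr V \<Longrightarrow> ap unit_op v = v"
  by (erule carrE) (simp add: unit_op_def pr_id pr_other[of _ 0] pr_other[of _ 1])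

lemma par_comp: "v \<in> comp V i \<Longrightarrow> ap par_op v = (if i = 0 then v else - v)"
  by (cases i) (simp_all add: par_op_def pr_id pr_other[of _ 0] pr_other[of _ 1])

text \<open>The image of \<open>unit_op\<close> is the carrier, so absorbing a right factor
  \<open>unit_op\<close> leaves only values on the carrier to compare.\<close>

lemma corner_eqI:
  assumes "a * unit_op = a" "b * unit_op = b" "\<And>v. v \<in> carr V \<Longrightarrow> ap a v = ap b v"
  shows "a = b"
proof (rule aend_eqI)
  fix v show "ap a v = ap b v"
    using assms(3)[OF unit_carr, of v] assms(1,2) by (metis ap_simps(5))
qed

definition opr :: "'k gl22 \<Rightarrow> 'v aend" where "opr X = Aend (\<lambda>v. act V X (ap unit_op v))"

lemma ap_opr: "X \<in> L \<Longrightarrow> ap (opr X) v = act V X (ap unit_op v)"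
  unfolding opr_def by (subst Aend_inverse) (simp_all add: act_add unit_carr)

lemma ap_opr_carr [simp]: "X \<in> L \<Longrightarrow> v \<in> carr V \<Longrightarrow> ap (opr X) v = act V X v"
  by (simp add: ap_opr unit_id)

lemma opr_unit [simp]:
  assumes X: "X \<in> L" shows "opr X * unit_op = opr X" "unit_op * opr X = opr X"
  by (rule aend_eqI; simp add: X ap_opr unit_id unit_carr act_carr)+

lemma opr_sc: "X \<in> L \<Longrightarrow> opr X * sc c = sc c * opr X"
  by (rule aend_eqI; simp add: ap_opr act_scl unit_carr)

lemma opr_add: "X \<in> L \<Longrightarrow> Y \<in> L \<Longrightarrow> opr (X + Y) = opr X + opr Y"
  and opr_mscale: "X \<in> L \<Longrightarrow> opr (mscale c X) = sc c * opr X"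
proof -
  interpret m: module mscale by (rule module_mscale)
  show "opr (X + Y) = opr X + opr Y" if "X \<in> L" "Y \<in> L"
    using that by (intro aend_eqI) (simp add: ap_opr act_add_left unit_carr m.subspace_add[OF L_subspace])
  show "opr (mscale c X) = sc c * opr X" if "X \<in> L"
    using that by (intro aend_eqI) (simp add: ap_opr act_mscale unit_carr m.subspace_scale[OF L_subspace])
qed

lemma opr_uminus: "X \<in> L \<Longrightarrow> opr (- X) = - opr X"
  using opr_mscale[of X "-1"] by (simp add: mscale_minus1)

lemma opr_0: "opr 0 = 0"
proof -
  interpret m: module mscale by (rule module_mscale)
  show ?thesis using opr_mscale[OF m.subspace_0[OF L_subspace], of 0] by simp
qed

lemma opr_par:
  assumes "X \<in> L" "X \<in> q2_part p"
  shows "opr X * par_op = (if p = 0 then par_op * opr X else - (par_op * opr X))"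
proof (rule corner_eqI)
  fix v assume "v \<in> carr V"
  then obtain v0 v1 where v: "v0 \<in> comp V 0" "v1 \<in> comp V 1" "v = v0 + v1" using carrE by blast
  have neg: "act V X (- v1) = - act V X v1" using act_scl[OF assms(1) comp_carr[OF v(2)], of "-1"] by simp
  have "ap par_op v = v0 - v1" using v par_comp[of v0 0] par_comp[of v1 1] by simp
  moreover have "- v1 \<in> comp V 1" using v subspace_neg[OF comp_subspace] by blast
  ultimately have "ap (opr X) (ap par_op v) = act V X v0 - act V X v1"
    using v assms(1) comp_carr by (simp add: ap_opr unit_id subspace_diff[OF carr_subspace] act_add[of X v0 "- v1"] neg flip: add_uminus_conv_diff)
  moreover have "ap par_op (ap (opr X) v) = ap par_op (act V X v0) + ap par_op (act V X v1)"
    using v assms(1) comp_carr by (simp add: unit_id ap_opr act_add)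
  ultimately show "ap (opr X * par_op) v = ap (if p = 0 then par_op * opr X else - (par_op * opr X)) v"
    using act_comp[OF assms v(1)] act_comp[OF assms v(2)]
    by (cases p) (simp_all add: par_comp[of _ 0] par_comp[of _ 1])
qed (simp_all add: mult.assoc assms)

lemma opr_sbracket:
  assumes "X \<in> L" "X \<in> q2_part p" "Y \<in> L" "Y \<in> q2_part q"
  shows "opr (sbracket p q X Y) = opr X * opr Y - sc (ksign p q) * (opr Y * opr X)"
  using assms L_sbracket[OF assms]
  by (intro aend_eqI) (simp add: ap_opr unit_carr unit_id act_carr act_sbracket)

lemma opr_commute:
  assumes "X \<in> L" "X \<in> q2_part p" "Y \<in> L" "Y \<in> q2_part q" "p = 0 \<or> q = 0" "sbracket p q X Y = Z"
  shows "opr X * opr Y = opr Y * opr X + opr Z"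
  using opr_sbracket[OF assms(1-4)] assms(5,6) by (auto simp: ksign_def)

lemma opr_anticommute:
  assumes "X \<in> L" "X \<in> q2_part 1" "Y \<in> L" "Y \<in> q2_part 1" "sbracket 1 1 X Y = Z"
  shows "opr X * opr Y = opr Z - opr Y * opr X"
  using opr_sbracket[OF assms(1-4)] assms(5) by (simp add: ksign_def algebra_simps)

end

section \<open>The operators of sq and their relations\<close>

locale sq_smod = smod scl L V
  for scl :: "'k::field_char_0 \<Rightarrow> 'v::ab_group_add \<Rightarrow> 'v" and L V +
  assumes sq2_subset: "sq2 \<subseteq> L"
begin

abbreviation "x_op \<equiv> opr Epos"
abbreviation "y_op \<equiv> opr Eneg"
abbreviation "h_op \<equiv> opr (H 1 - H 2)"
abbreviation "z_op \<equiv> opr (H 1 + H 2)"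
abbreviation "E_op \<equiv> opr Ebar"
abbreviation "F_op \<equiv> opr Fbar"
abbreviation "K_op \<equiv> opr (Hbar 1 - Hbar 2)"

lemma gens_L [simp]: "block A 0 \<in> L" "Ebar \<in> L" "Fbar \<in> L" "Hbar 1 - Hbar 2 \<in> L" "H 1 + H 2 \<in> L" "H 1 - H 2 \<in> L"
  using sq2_subset by (auto intro!: subsetD[OF sq2_subset] simp: elements)

lemma gens_parity [simp]: "block A 0 \<in> q2_part 0" "H 1 + H 2 \<in> q2_part 0" "H 1 - H 2 \<in> q2_part 0"
  "Ebar \<in> q2_part 1" "Fbar \<in> q2_part 1" "Hbar 1 - Hbar 2 \<in> q2_part 1"
  by (simp_all add: elements)

text \<open>The superbracket of an odd element with itself is twice its square. In characteristic
  zero the factor is removed by the scalar 1/2.\<close>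

lemma double_cancel: "a + a = b + b \<Longrightarrow> a = (b :: 'v aend)"
proof -
  assume "a + a = b + b"
  then have "sc (1/2) * (a + a) = sc (1/2) * (b + b)" by simp
  moreover have "sc (1/2) * (c + c) = c" for c :: "'v aend"
  proof -
    have "sc (1/2) * (c + c) = (sc (1/2) + sc (1/2)) * c" by (simp only: distrib_left distrib_right)
    also have "\<dots> = c" by (simp flip: sc_simps(5))
    finally show ?thesis .
  qed
  ultimately show "a = b" by simp
qed

lemma opr_double: "X \<in> L \<Longrightarrow> opr (X + X) = opr X + opr X" "X \<in> L \<Longrightarrow> opr (- X - X) = - (opr X + opr X)"
  using opr_add[of X X] opr_add[of "- X" "- X"] opr_uminus[of X]
    module.subspace_neg[OF module_mscale L_subspace, of X] by (simp_all only: diff_conv_add_uminus minus_add_distrib)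

lemma brackets:
  "sbracket 0 0 Eneg Epos = - (H 1 - H 2)"
  "sbracket 0 0 (H 1 - H 2) Epos = Epos + Epos"
  "sbracket 0 0 (H 1 - H 2) Eneg = - Eneg - Eneg"
  "sbracket 1 0 Ebar Epos = 0"
  "sbracket 1 0 Fbar Epos = - (Hbar 1 - Hbar 2)"
  "sbracket 1 0 (Hbar 1 - Hbar 2) Epos = Ebar + Ebar"
  "sbracket 1 0 Ebar Eneg = Hbar 1 - Hbar 2"
  "sbracket 1 0 Fbar Eneg = 0"
  "sbracket 1 0 (Hbar 1 - Hbar 2) Eneg = - Fbar - Fbar"
  "sbracket 1 0 Ebar (H 1 - H 2) = - Ebar - Ebar"
  "sbracket 1 0 Fbar (H 1 - H 2) = Fbar + Fbar"
  "sbracket 1 0 (Hbar 1 - Hbar 2) (H 1 - H 2) = 0"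
  "sbracket 1 1 Fbar Ebar = H 1 + H 2"
  "sbracket 1 1 (Hbar 1 - Hbar 2) Ebar = 0"
  "sbracket 1 1 (Hbar 1 - Hbar 2) Fbar = 0"
  "sbracket 1 1 Ebar Ebar = 0"
  "sbracket 1 1 Fbar Fbar = 0"
  "sbracket 1 1 (Hbar 1 - Hbar 2) (Hbar 1 - Hbar 2) = (H 1 + H 2) + (H 1 + H 2)"
  "sbracket 0 0 Epos (H 1 + H 2) = 0"
  "sbracket 0 0 Eneg (H 1 + H 2) = 0"
  "sbracket 0 0 (H 1 - H 2) (H 1 + H 2) = 0"
  "sbracket 1 0 Ebar (H 1 + H 2) = 0"
  "sbracket 1 0 Fbar (H 1 + H 2) = 0"
  "sbracket 1 0 (Hbar 1 - Hbar 2) (H 1 + H 2) = 0"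
  by (simp_all add: elements gl2_eq_iff gl2_mult_nth block_uminus flip: block_zero)

text \<open>Only brackets of elements of sq enter, so the relations hold for every \<open>L\<close>
  containing \<open>sq2\<close>. The calculations that follow thus serve sq-supermodules and
  q-supermodules alike.\<close>

sublocale rel: sq_relations x_op y_op h_op z_op E_op F_op K_op
proof
  show "y_op * x_op = x_op * y_op - h_op"
    by (subst opr_commute[OF _ _ _ _ _ brackets(1)]) (simp_all only: opr_double opr_0 opr_uminus gens_L gens_parity, simp_all)
  show "h_op * x_op = x_op * h_op + (x_op + x_op)"
    by (subst opr_commute[OF _ _ _ _ _ brackets(2)]) (simp_all only: opr_double opr_0 opr_uminus gens_L gens_parity, simp_all)
  show "h_op * y_op = y_op * h_op - (y_op + y_op)"
    by (subst opr_commute[OF _ _ _ _ _ brackets(3)]) (simp_all only: opr_double opr_0 opr_uminus gens_L gens_parity, simp_all)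
  show "E_op * x_op = x_op * E_op"
    by (subst opr_commute[OF _ _ _ _ _ brackets(4)]) (simp_all only: opr_double opr_0 opr_uminus gens_L gens_parity, simp_all)
  show "F_op * x_op = x_op * F_op - K_op"
    by (subst opr_commute[OF _ _ _ _ _ brackets(5)]) (simp_all only: opr_double opr_0 opr_uminus gens_L gens_parity, simp_all)
  show "K_op * x_op = x_op * K_op + (E_op + E_op)"
    by (subst opr_commute[OF _ _ _ _ _ brackets(6)]) (simp_all only: opr_double opr_0 opr_uminus gens_L gens_parity, simp_all)
  show "E_op * y_op = y_op * E_op + K_op"
    by (subst opr_commute[OF _ _ _ _ _ brackets(7)]) (simp_all only: opr_double opr_0 opr_uminus gens_L gens_parity, simp_all)
  show "F_op * y_op = y_op * F_op"
    by (subst opr_commute[OF _ _ _ _ _ brackets(8)]) (simp_all only: opr_double opr_0 opr_uminus gens_L gens_parity, simp_all)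
  show "K_op * y_op = y_op * K_op - (F_op + F_op)"
    by (subst opr_commute[OF _ _ _ _ _ brackets(9)]) (simp_all only: opr_double opr_0 opr_uminus gens_L gens_parity, simp_all)
  show "E_op * h_op = h_op * E_op - (E_op + E_op)"
    by (subst opr_commute[OF _ _ _ _ _ brackets(10)]) (simp_all only: opr_double opr_0 opr_uminus gens_L gens_parity, simp_all)
  show "F_op * h_op = h_op * F_op + (F_op + F_op)"
    by (subst opr_commute[OF _ _ _ _ _ brackets(11)]) (simp_all only: opr_double opr_0 opr_uminus gens_L gens_parity, simp_all)
  show "K_op * h_op = h_op * K_op"
    by (subst opr_commute[OF _ _ _ _ _ brackets(12)]) (simp_all only: opr_double opr_0 opr_uminus gens_L gens_parity, simp_all)
  show "F_op * E_op = z_op - E_op * F_op"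
    by (subst opr_anticommute[OF _ _ _ _ brackets(13)]) (simp_all add: opr_0 del: q2_part_0 q2_part_1)
  show "K_op * E_op = - (E_op * K_op)"
    by (subst opr_anticommute[OF _ _ _ _ brackets(14)]) (simp_all add: opr_0 del: q2_part_0 q2_part_1)
  show "K_op * F_op = - (F_op * K_op)"
    by (subst opr_anticommute[OF _ _ _ _ brackets(15)]) (simp_all add: opr_0 del: q2_part_0 q2_part_1)
  show "E_op * E_op = 0"
    by (rule double_cancel, subst opr_anticommute[OF _ _ _ _ brackets(16)])
      (simp_all only: opr_double opr_0 gens_L gens_parity, simp_all)
  show "F_op * F_op = 0"
    by (rule double_cancel, subst opr_anticommute[OF _ _ _ _ brackets(17)])
      (simp_all only: opr_double opr_0 gens_L gens_parity, simp_all)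
  show "K_op * K_op = z_op"
    by (rule double_cancel, subst opr_anticommute[OF _ _ _ _ brackets(18)])
      (simp_all only: opr_double opr_0 gens_L gens_parity, simp_all)
  show "x_op * z_op = z_op * x_op"
    by (subst opr_commute[OF _ _ _ _ _ brackets(19)]) (simp_all only: opr_double opr_0 opr_uminus gens_L gens_parity, simp_all)
  show "y_op * z_op = z_op * y_op"
    by (subst opr_commute[OF _ _ _ _ _ brackets(20)]) (simp_all only: opr_double opr_0 opr_uminus gens_L gens_parity, simp_all)
  show "h_op * z_op = z_op * h_op"
    by (subst opr_commute[OF _ _ _ _ _ brackets(21)]) (simp_all only: opr_double opr_0 opr_uminus gens_L gens_parity, simp_all)
  show "E_op * z_op = z_op * E_op"
    by (subst opr_commute[OF _ _ _ _ _ brackets(22)]) (simp_all only: opr_double opr_0 opr_uminus gens_L gens_parity, simp_all)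
  show "F_op * z_op = z_op * F_op"
    by (subst opr_commute[OF _ _ _ _ _ brackets(23)]) (simp_all only: opr_double opr_0 opr_uminus gens_L gens_parity, simp_all)
  show "K_op * z_op = z_op * K_op"
    by (subst opr_commute[OF _ _ _ _ _ brackets(24)]) (simp_all only: opr_double opr_0 opr_uminus gens_L gens_parity, simp_all)
qed

text \<open>Both elements are sums of words with an odd number of odd letters. The family
  \<open>N\<close> is kept general: for \<open>comp V\<close> this says that they are odd operators,
  and for a graded subsupermodule of the restriction it is the key to stability under q.\<close>

lemma sq2_gens_stable:
  assumes N: "\<And>i. subspace (N i)" "\<And>i. N i \<subseteq> comp V i"
    and GN: "\<And>p i X v. X \<in> sq2_gens p \<Longrightarrow> v \<in> N i \<Longrightarrow> act V X v \<in> N (p + i)"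
    and v: "v \<in> N i"
  shows "ap rel.clif v \<in> N (i + 1)" "ap rel.ocas v \<in> N (i + 1)"
proof -
  have mem: "ap (opr X) v \<in> N (p + i)" if "X \<in> L" "X \<in> sq2_gens p" "v \<in> N i" for X p i v
    using that GN[OF that(2,3)] N(2)[of i] comp_carr[of v i] by (subst ap_opr_carr) auto
  have even: "ap x_op v \<in> N i" "ap y_op v \<in> N i" "ap h_op v \<in> N i" "ap z_op v \<in> N i" if "v \<in> N i" for v i
    using that mem[of _ 0 v i, unfolded add_0] by (simp_all add: sq2_gens_def)
  have odd: "ap E_op v \<in> N (i + 1)" "ap F_op v \<in> N (i + 1)" "ap K_op v \<in> N (i + 1)" if "v \<in> N i" for v i
    using that mem[of _ 1 v i] by (auto simp: sq2_gens_def add.commute)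
  have odd': "ap E_op v \<in> N i" "ap F_op v \<in> N i" "ap K_op v \<in> N i" if "v \<in> N (i + 1)" for v i
    using odd[OF that] by (cases i; simp)+
  note intros = subspace_add[OF N(1)] subspace_diff[OF N(1)] even odd odd' v
  show *: "ap rel.clif v \<in> N (i + 1)"
    unfolding rel.clif_def ap_simps by (intro intros)
  show "ap rel.ocas v \<in> N (i + 1)"
    unfolding rel.ocas_def ap_simps by (intro intros *)
qed

lemma sq2_gens_L: "X \<in> sq2_gens p \<Longrightarrow> X \<in> L" and sq2_gens_parity: "X \<in> sq2_gens p \<Longrightarrow> X \<in> q2_part p"
  by (cases p; force simp: sq2_gens_def simp del: q2_part_0 q2_part_1)+

lemma clif_comp: "v \<in> comp V i \<Longrightarrow> ap rel.clif v \<in> comp V (i + 1)"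
  and ocas_comp: "v \<in> comp V i \<Longrightarrow> ap rel.ocas v \<in> comp V (i + 1)"
  by (rule sq2_gens_stable[of "comp V"]; use comp_subspace act_comp sq2_gens_L sq2_gens_parity in blast)+

lemma clif_unit [simp]: "rel.clif * unit_op = rel.clif" "unit_op * rel.clif = rel.clif"
  and ocas_unit [simp]: "rel.ocas * unit_op = rel.ocas" "unit_op * rel.ocas = rel.ocas"
  by (simp_all add: rel.clif_def rel.ocas_def algebra_simps) (simp_all add: mult.assoc[symmetric])

lemma opr_par_gens:
  "x_op * par_op = par_op * x_op" "y_op * par_op = par_op * y_op" "h_op * par_op = par_op * h_op"
  "z_op * par_op = par_op * z_op" "E_op * par_op = - (par_op * E_op)" "F_op * par_op = - (par_op * F_op)"
  "K_op * par_op = - (par_op * K_op)"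
  using opr_par[OF gens_L(1) gens_parity(1)] opr_par[OF gens_L(5) gens_parity(2)] opr_par[OF gens_L(6) gens_parity(3)]
    opr_par[OF gens_L(2) gens_parity(4)] opr_par[OF gens_L(3) gens_parity(5)] opr_par[OF gens_L(4) gens_parity(6)]
  by simp_all

lemma par_clif: "rel.clif * par_op = - (par_op * rel.clif)" and par_ocas: "rel.ocas * par_op = - (par_op * rel.ocas)"
  using rel.anticommute_ocas[of par_op] opr_par_gens by simp_all

lemma sc_clif: "rel.clif * sc c = sc c * rel.clif" and sc_ocas: "rel.ocas * sc c = sc c * rel.ocas"
  using rel.commute_ocas[of "sc c"] by (simp_all add: opr_sc)

end

section \<open>Typical supermodules and the operators T and Z\<close>

locale typ_smod = sq_smod scl L V
  for scl :: "'k::field_char_0 \<Rightarrow> 'v::ab_group_add \<Rightarrow> 'v" and L V +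
  fixes c :: 'k
  assumes c_nz: "c \<noteq> 0" and central: "\<And>v. v \<in> carr V \<Longrightarrow> act V (H 1 + H 2) v = scl c v"
begin

lemma z_op_eq: "z_op = sc c * unit_op"
  by (rule corner_eqI) (simp_all add: mult.assoc unit_id central)

text \<open>The anticommutators of \<open>ocas\<close> carry a factor \<open>z * z\<close>, which
  acts by \<open>c * c\<close>; dividing by it gives the element \<open>T\<close> of the
  overview.\<close>

definition T_op where "T_op = sc (1 / (c * c)) * rel.ocas"

lemma T_commute:
  "T_op * x_op = x_op * T_op" "T_op * y_op = y_op * T_op" "T_op * h_op = h_op * T_op" "T_op * z_op = z_op * T_op"
  using opr_sc[THEN assoc_rule] by (simp_all add: T_op_def mult.assoc rel.ocas_commute)

lemma T_anticommute:
  "T_op * E_op + E_op * T_op = x_op + x_op" "T_op * F_op + F_op * T_op = y_op + y_op" "T_op * K_op + K_op * T_op = h_op + h_op"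
proof -
  have *: "sc (1 / (c * c)) * (z_op * (z_op * (opr X + opr X))) = opr X + opr X" if "X \<in> L" for X
  proof -
    have "z_op * (z_op * (opr X + opr X)) = sc (c * c) * (opr X + opr X)"
      by (simp add: z_op_eq mult.assoc distrib_left that unit_simps(5)[THEN assoc_rule]) (simp add: mult.assoc[symmetric])
    then show ?thesis using c_nz by (simp add: mult.assoc[symmetric])
  qed
  have e: "T_op * opr X + opr X * T_op = sc (1 / (c * c)) * (rel.ocas * opr X + opr X * rel.ocas)" if "X \<in> L" for X
    using opr_sc[OF that, THEN assoc_rule] by (simp add: T_op_def mult.assoc distrib_left)
  show "T_op * E_op + E_op * T_op = x_op + x_op" "T_op * F_op + F_op * T_op = y_op + y_op" "T_op * K_op + K_op * T_op = h_op + h_op"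
    by (simp_all only: e gens_L rel.ocas_anticommute *)
qed

lemma T_clif: "T_op * rel.clif = rel.clif * T_op"
  using rel.commute_ocas(2)[of rel.clif] rel.clif_commute sc_clif[THEN assoc_rule] by (simp add: T_op_def mult.assoc)

lemma T_par: "T_op * par_op = - (par_op * T_op)"
  by (simp add: T_op_def mult.assoc par_ocas) (simp add: mult.assoc[symmetric])

lemma T_sc: "T_op * sc d = sc d * T_op"
  by (simp add: T_op_def mult.assoc sc_ocas) (simp add: mult.assoc[symmetric] mult.commute)

lemma T_unit [simp]: "T_op * unit_op = T_op" "unit_op * T_op = T_op"
  by (simp_all add: T_op_def mult.assoc) (simp add: mult.assoc[symmetric], simp add: mult.assoc)

lemma clif_square: "rel.clif * rel.clif = sc (c * c * c) * unit_op"
  unfolding rel.clif_square z_op_eq by (simp add: mult.assoc unit_simps(5)[THEN assoc_rule]) (simp add: mult.assoc[symmetric])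

text \<open>The candidates for the action of \<^const>\<open>odd_unit\<close>: by Schur's lemma it can only act by one of
  these, and each of them satisfies all relations of \<open>q\<close> except the one for its square.\<close>

definition Z_op :: "'k \<Rightarrow> 'v aend" where "Z_op l = T_op + sc l * (par_op * rel.clif)"

text \<open>\<open>w\<close> commutes with sq, and the factor \<open>s\<close> supplies exactly the
  signs expected of an odd operator. So \<open>s w\<close> supercommutes with sq, and adding
  multiples of it to \<open>T\<close> leaves all supercommutators unchanged.\<close>

lemma par_clif_gens:
  "(par_op * rel.clif) * x_op = x_op * (par_op * rel.clif)" "(par_op * rel.clif) * y_op = y_op * (par_op * rel.clif)"
  "(par_op * rel.clif) * h_op = h_op * (par_op * rel.clif)" "(par_op * rel.clif) * z_op = z_op * (par_op * rel.clif)"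
  "(par_op * rel.clif) * E_op = - (E_op * (par_op * rel.clif))" "(par_op * rel.clif) * F_op = - (F_op * (par_op * rel.clif))"
  "(par_op * rel.clif) * K_op = - (K_op * (par_op * rel.clif))"
  by (simp_all add: mult.assoc rel.clif_commute) (simp_all add: mult.assoc[symmetric] opr_par_gens)

lemma Z_commute:
  "Z_op l * x_op = x_op * Z_op l" "Z_op l * y_op = y_op * Z_op l" "Z_op l * h_op = h_op * Z_op l" "Z_op l * z_op = z_op * Z_op l"
  using opr_sc[THEN assoc_rule, of _ l "par_op * rel.clif"]
  by (simp_all add: Z_op_def distrib_left distrib_right T_commute mult.assoc[of "sc l"] par_clif_gens)

lemma Z_anticommute:
  "Z_op l * E_op + E_op * Z_op l = x_op + x_op" "Z_op l * F_op + F_op * Z_op l = y_op + y_op" "Z_op l * K_op + K_op * Z_op l = h_op + h_op"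
proof -
  have *: "Z_op l * opr X + opr X * Z_op l = T_op * opr X + opr X * T_op"
    if "X \<in> L" "(par_op * rel.clif) * opr X = - (opr X * (par_op * rel.clif))" for X
    using opr_sc[OF that(1), THEN assoc_rule, of l "par_op * rel.clif"] that(2)
    by (simp add: Z_op_def distrib_left distrib_right mult.assoc[of "sc l"])
  show "Z_op l * E_op + E_op * Z_op l = x_op + x_op" "Z_op l * F_op + F_op * Z_op l = y_op + y_op" "Z_op l * K_op + K_op * Z_op l = h_op + h_op"
    by (simp_all only: * gens_L par_clif_gens T_anticommute)
qed

lemma Z_unit [simp]: "Z_op l * unit_op = Z_op l" "unit_op * Z_op l = Z_op l"
proof -
  have "unit_op * (sc l * (par_op * rel.clif)) = sc l * (par_op * rel.clif)"
    using unit_simps(3) by (simp add: mult.assoc[symmetric]) (simp add: mult.assoc unit_simps(2)[THEN assoc_rule])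
  then show "Z_op l * unit_op = Z_op l" "unit_op * Z_op l = Z_op l"
    by (simp_all add: Z_op_def distrib_left distrib_right mult.assoc)
qed

lemma par_clif_square: "(par_op * rel.clif) * (par_op * rel.clif) = - (sc (c * c * c) * unit_op)"
proof -
  have "(par_op * rel.clif) * (par_op * rel.clif) = par_op * ((rel.clif * par_op) * rel.clif)" by (simp add: mult.assoc)
  also have "\<dots> = - ((par_op * par_op) * (rel.clif * rel.clif))" unfolding par_clif by (simp only: mult.assoc mult_minus_left mult_minus_right)
  also have "\<dots> = - (sc (c * c * c) * unit_op)"
    unfolding clif_square unit_simps(4) by (simp add: mult.assoc unit_simps(5)[THEN assoc_rule])
  finally show ?thesis .
qed

lemma sc_par_clif: "(par_op * rel.clif) * sc d = sc d * (par_op * rel.clif)"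
  by (simp add: mult.assoc sc_clif) (simp add: mult.assoc[symmetric])

lemma Z_sc: "Z_op l * sc d = sc d * Z_op l"
  by (simp add: Z_op_def distrib_left distrib_right T_sc mult.assoc[of "sc l"] sc_par_clif)
    (simp add: mult.assoc[symmetric] mult.commute)

lemma T_par_clif: "T_op * (par_op * rel.clif) = - ((par_op * rel.clif) * T_op)"
  using T_par[THEN assoc_rule, of rel.clif] T_clif by (simp add: mult.assoc)

text \<open>\<open>T\<close> and \<open>s w\<close> anticommute, so the mixed terms cancel; the sign
  of the last term arises because \<open>s\<close> and \<open>w\<close> anticommute, whence
  \<open>(s w)^2 = - w^2\<close>.\<close>

lemma Z_square: "Z_op l * Z_op l = T_op * T_op - sc (l * l * (c * c * c)) * unit_op"
proof -
  let ?u = "par_op * rel.clif"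
  have "(sc l * ?u) * (sc l * ?u) = sc l * ((?u * sc l) * ?u)" by (simp only: mult.assoc)
  also have "\<dots> = (sc l * sc l) * (?u * ?u)" unfolding sc_par_clif by (simp only: mult.assoc)
  also have "\<dots> = - (sc (l * l * (c * c * c)) * unit_op)" unfolding par_clif_square by (simp add: mult.assoc[symmetric])
  finally have 1: "(sc l * ?u) * (sc l * ?u) = - (sc (l * l * (c * c * c)) * unit_op)" .
  have "T_op * (sc l * ?u) = sc l * (T_op * ?u)" by (simp only: mult.assoc[symmetric] T_sc)
  also have "\<dots> = - ((sc l * ?u) * T_op)" unfolding T_par_clif by (simp add: mult.assoc)
  finally show ?thesis by (simp add: Z_op_def distrib_left distrib_right 1)
qed

lemma Z_comp: "v \<in> comp V i \<Longrightarrow> ap (Z_op l) v \<in> comp V (i + 1)"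
  using clif_comp[of v i] ocas_comp[of v i]
  by (cases i) (simp_all add: Z_op_def T_op_def par_comp[of _ 0] par_comp[of _ 1] subspace_add[OF comp_subspace] subspace_scale[OF comp_subspace] subspace_diff[OF comp_subspace])

text \<open>\<open>w\<close> commutes with \<open>T\<close> and anticommutes with
  \<open>s w\<close>. Being odd and invertible, it will carry the extension with parameter
  \<open>l\<close> to the parity change of the one with \<open>- l\<close>.\<close>

lemma clif_Z: "rel.clif * Z_op l = Z_op (- l) * rel.clif"
proof -
  have "rel.clif * (sc l * (par_op * rel.clif)) = sc l * ((rel.clif * par_op) * rel.clif)"
    by (simp only: mult.assoc[symmetric] sc_clif)
  then have "rel.clif * (sc l * (par_op * rel.clif)) = - (sc l * (par_op * (rel.clif * rel.clif)))"
    unfolding par_clif by (simp add: mult.assoc)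
  then show ?thesis by (simp add: Z_op_def distrib_left left_diff_distrib T_clif mult.assoc)
qed

end

section \<open>Simple supermodules and Schur's lemma for operators\<close>

locale simple_smod = smod scl L V
  for scl :: "'k::{alg_closed_field, field_char_0} \<Rightarrow> 'v::ab_group_add \<Rightarrow> 'v" and L V +
  fixes G :: "bit \<Rightarrow> 'k gl22 set"
  assumes uncountable: "uncountable (UNIV :: 'k set)" and generating: "generating L G"
    and simple: "simple_supermodule scl L V"
begin

lemma G_L: "X \<in> G p \<Longrightarrow> X \<in> L"
  using generating unfolding generating_def by blast

lemma nonzero_vector: obtains v i where "v \<in> comp V i" "v \<noteq> 0"
proof -
  obtain i where "comp V i \<noteq> {0}" using simple by (fastforce simp: simple_supermodule_def)
  then show ?thesis using comp_0 that by blast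
qed

lemma schur_op:
  assumes P: "P * unit_op = P" "\<And>a. P * sc a = sc a * P" "\<And>i v. v \<in> comp V i \<Longrightarrow> ap P v \<in> comp V i"
    and comm: "\<And>p X. X \<in> G p \<Longrightarrow> P * opr X = opr X * P"
  shows "\<exists>a. P = sc a * unit_op"
proof -
  have Pc: "ap P v \<in> carr V" if "v \<in> carr V" for v
    using that P(3) by (elim carrE) (auto intro!: subspace_add[OF carr_subspace] intro: comp_carr)
  have "\<exists>a. \<forall>v\<in>carr V. ap P v = scl a v"
  proof (rule schur[OF smod_axioms uncountable generating simple])
    have "ap P (scl a v) = scl a (ap P v)" for a v
      using arg_cong[OF P(2), of "\<lambda>f. ap f v"] by simp
    then show "linear_on_carr scl (carr V) (ap P)" by (simp add: linear_on_carr_def)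
    show "ap P (act V X v) = act V X (ap P v)" if "X \<in> G p" "v \<in> carr V" for p X v
      using arg_cong[OF comm[OF that(1)], of "\<lambda>f. ap f v"] that G_L Pc by simp
  qed (rule P(3))
  then obtain a where a: "\<And>v. v \<in> carr V \<Longrightarrow> ap P v = scl a v" by blast
  have "P = sc a * unit_op"
  proof (rule corner_eqI)
    show "ap P v = ap (sc a * unit_op) v" if "v \<in> carr V" for v
      using a[OF that] by (simp add: unit_id[OF that])
  qed (simp_all only: P(1) mult.assoc unit_simps)
  then show ?thesis by blast
qed

end

locale simple_typ = simple_smod scl L V G + typ_smod scl L V c
  for scl :: "'k::{alg_closed_field, field_char_0} \<Rightarrow> 'v::ab_group_add \<Rightarrow> 'v" and L V G c

locale sq_simple = simple_typ scl sq2 V sq2_gens c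
  for scl :: "'k::{alg_closed_field, field_char_0} \<Rightarrow> 'v::ab_group_add \<Rightarrow> 'v" and V c

locale q_simple = simple_typ scl q2 V q2_gens c
  for scl :: "'k::{alg_closed_field, field_char_0} \<Rightarrow> 'v::ab_group_add \<Rightarrow> 'v" and V c

lemma (in typ_smod) T_op_eq: "T_op = Z_op 0"
  by (simp add: Z_op_def)

text \<open>\<open>T^2\<close> commutes with the even generators as \<open>T\<close> does, and with
  an odd \<open>X\<close> because \<open>T X + X T\<close> commutes with \<open>T\<close>. So it is
  a scalar \<open>a\<close> by Schur's lemma, and it remains to choose \<open>l\<close>.\<close>

lemma (in sq_simple) ex_Z_square: "\<exists>l. Z_op l * Z_op l = z_op"
proof -
  have even: "T_op * T_op * opr X = opr X * (T_op * T_op)" if "T_op * opr X = opr X * T_op" for X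
    using that by (metis mult.assoc)
  have odd: "T_op * T_op * opr X = opr X * (T_op * T_op)" if "T_op * opr X + opr X * T_op = Y" "T_op * Y = Y * T_op" for X Y
  proof -
    have X: "T_op * opr X = Y - opr X * T_op" using that(1) by (simp add: algebra_simps)
    show ?thesis by (simp add: mult.assoc X right_diff_distrib that(2)) (simp add: mult.assoc[symmetric] X left_diff_distrib)
  qed
  have "\<exists>a. T_op * T_op = sc a * unit_op"
  proof (rule schur_op)
    show "T_op * T_op * sc a = sc a * (T_op * T_op)" for a using T_sc by (metis mult.assoc)
    show "ap (T_op * T_op) v \<in> comp V i" if "v \<in> comp V i" for i v
      using Z_comp[OF Z_comp[OF that], of 0 0] by (cases i) (simp_all add: T_op_eq)
    have "\<forall>X\<in>sq2_gens 0. T_op * T_op * opr X = opr X * (T_op * T_op)"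
      using T_commute even by (simp add: sq2_gens_def)
    moreover have "\<forall>X\<in>sq2_gens 1. T_op * T_op * opr X = opr X * (T_op * T_op)"
      using odd[OF T_anticommute(1)] odd[OF T_anticommute(2)] odd[OF T_anticommute(3)]
      by (simp add: sq2_gens_def distrib_left distrib_right T_commute)
    ultimately show "T_op * T_op * opr X = opr X * (T_op * T_op)" if "X \<in> sq2_gens p" for p X
      using that by (cases p; metis)
  qed (simp add: mult.assoc)
  then obtain a where a: "T_op * T_op = sc a * unit_op" by blast
  \<comment> \<open>This \<open>l\<close> solves \<open>a - l^2 c^3 = c\<close>; the square root
    exists since the field is algebraically closed.\<close>
  obtain l where "l ^ 2 = (a - c) / (c * c * c)"
    using nth_root_exists[of 2 "(a - c) / (c * c * c)"] by auto
  then have "a - l * l * (c * c * c) = c" using c_nz by (simp add: power2_eq_square)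
  then have "sc (a - l * l * (c * c * c)) * unit_op = z_op" by (simp only: z_op_eq)
  moreover have "sc (a - b) * unit_op = sc a * unit_op - sc b * unit_op" for b
    using sc_simps(5)[of a "- b"] by (simp add: left_diff_distrib)
  ultimately have "Z_op l * Z_op l = z_op" unfolding Z_square a by simp
  then show ?thesis by blast
qed

context q_simple
begin

abbreviation "q_op \<equiv> opr odd_unit"

lemma odd_unit_L [simp]: "odd_unit \<in> q2" "odd_unit \<in> q2_part 1"
  by (simp_all add: odd_unit_def)

lemma odd_unit_brackets:
  "sbracket 1 0 odd_unit (block A 0) = 0" "sbracket 1 0 odd_unit (H 1 + H 2) = 0"
  "sbracket 1 0 odd_unit (H 1 - H 2) = 0"
  "sbracket 1 1 odd_unit Ebar = Epos + Epos" "sbracket 1 1 odd_unit Fbar = Eneg + Eneg"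
  "sbracket 1 1 odd_unit (Hbar 1 - Hbar 2) = (H 1 - H 2) + (H 1 - H 2)"
  "sbracket 1 1 odd_unit odd_unit = (H 1 + H 2) + (H 1 + H 2)"
  by (simp_all add: elements gl2_eq_iff gl2_mult_nth flip: block_zero)

lemma q_commute: "q_op * x_op = x_op * q_op" "q_op * y_op = y_op * q_op" "q_op * h_op = h_op * q_op" "q_op * z_op = z_op * q_op"
  by (subst opr_commute[OF _ _ _ _ _ odd_unit_brackets(1)] opr_commute[OF _ _ _ _ _ odd_unit_brackets(2)]
      opr_commute[OF _ _ _ _ _ odd_unit_brackets(3)]; simp add: opr_0 del: q2_part_0 q2_part_1)+

lemma q_anticommute: "q_op * E_op + E_op * q_op = x_op + x_op" "q_op * F_op + F_op * q_op = y_op + y_op"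
  "q_op * K_op + K_op * q_op = h_op + h_op"
  by (subst opr_anticommute[OF odd_unit_L gens_L(2) gens_parity(4) odd_unit_brackets(4)]
        opr_anticommute[OF odd_unit_L gens_L(3) gens_parity(5) odd_unit_brackets(5)]
        opr_anticommute[OF odd_unit_L gens_L(4) gens_parity(6) odd_unit_brackets(6)],
      simp only: opr_double gens_L, simp)+

lemma q_square: "q_op * q_op = z_op"
proof (rule double_cancel)
  show "q_op * q_op + q_op * q_op = z_op + z_op"
    using opr_anticommute[OF odd_unit_L odd_unit_L odd_unit_brackets(7)]
    by (simp only: opr_double gens_L eq_diff_eq)
qed

text \<open>\<open>D = Z - T\<close> supercommutes with sq, as does \<open>u = w s = - s w\<close>.
  Hence \<open>D u\<close> is an even operator commuting with all of q, and Schur's lemma applies to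
  it.\<close>

lemma q_op_eq: "\<exists>l. q_op = Z_op l"
proof -
  define D where "D = q_op - T_op"
  define u where "u = rel.clif * par_op"
  have u: "u = - (par_op * rel.clif)" by (simp add: u_def par_clif)
  have D_even: "D * x_op = x_op * D" "D * y_op = y_op * D" "D * h_op = h_op * D" "D * z_op = z_op * D"
    by (simp_all add: D_def left_diff_distrib right_diff_distrib q_commute T_commute)
  have D_odd: "D * E_op = - (E_op * D)" "D * F_op = - (F_op * D)" "D * K_op = - (K_op * D)"
    using q_anticommute T_anticommute unfolding D_def left_diff_distrib right_diff_distrib
    by (simp_all add: algebra_simps)
  have D_T: "D * T_op = - (T_op * D)" and D_clif: "D * rel.clif = - (rel.clif * D)"
  proof -
    have Dsc: "D * sc (1 / (c * c)) = sc (1 / (c * c)) * D"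
      by (simp add: D_def left_diff_distrib right_diff_distrib opr_sc T_sc)
    show "D * T_op = - (T_op * D)"
      using rel.anticommute_ocas(2)[of D, OF D_even D_odd] by (simp add: T_op_def mult.assoc Dsc[THEN assoc_rule])
    show "D * rel.clif = - (rel.clif * D)" by (rule rel.anticommute_ocas(1)[of D, OF D_even D_odd])
  qed
  have D_par: "D * par_op = - (par_op * D)"
    using opr_par[OF odd_unit_L] by (simp add: D_def left_diff_distrib right_diff_distrib T_par)
  have u_even: "u * x_op = x_op * u" "u * y_op = y_op * u" "u * h_op = h_op * u" "u * z_op = z_op * u"
    and u_odd: "u * E_op = - (E_op * u)" "u * F_op = - (F_op * u)" "u * K_op = - (K_op * u)"
    by (simp_all add: u par_clif_gens)
  have u_T: "u * T_op = - (T_op * u)" by (simp add: u T_par_clif)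
  have u_D: "u * D = D * u" 
    by (simp add: u_def mult.assoc D_par D_clif[THEN assoc_rule])
  \<comment> \<open>A product commutes with \<open>b\<close> if its two factors both commute or both
    anticommute with \<open>b\<close>.\<close>
  have cc: "(D * u) * b = b * (D * u)" if "D * b = b * D" "u * b = b * u" for b
    using that(1)[THEN assoc_rule] by (simp add: that mult.assoc)
  have aa: "(D * u) * b = b * (D * u)" if "D * b = - (b * D)" "u * b = - (b * u)" for b
    using that(1)[THEN assoc_rule] by (simp add: that mult.assoc)
  have uu: "u * u = - (sc (c * c * c) * unit_op)" by (simp add: u par_clif_square)
  have "\<exists>a. D * u = sc a * unit_op"
  proof (rule schur_op)
    show "D * u * unit_op = D * u" by (simp add: u mult.assoc)
    show "D * u * sc a = sc a * (D * u)" for a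
    proof (rule cc)
      show "D * sc a = sc a * D" by (simp add: D_def left_diff_distrib right_diff_distrib opr_sc T_sc)
      show "u * sc a = sc a * u" by (simp add: u sc_par_clif)
    qed
    show "ap (D * u) v \<in> comp V i" if v: "v \<in> comp V i" for i v
    proof -
      have D: "ap D w \<in> comp V (j + 1)" if "w \<in> comp V j" for w j
        using that Z_comp[OF that, of 0] act_comp[OF odd_unit_L that] 
        by (simp add: D_def T_op_eq comp_carr add.commute subspace_diff[OF comp_subspace])
      have "ap u v \<in> comp V (i + 1)"
        using clif_comp[OF v] subspace_neg[OF comp_subspace clif_comp[OF v]] by (cases i) (simp_all add: u par_comp[of _ 0] par_comp[of _ 1])
      from D[OF this] show ?thesis by (cases i) simp_all
    qed
    \<comment> \<open>Write \<open>Z = D + T\<close>: \<open>D\<close> and \<open>u\<close> commute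
      with each other, and both anticommute with \<open>T\<close>.\<close>
    have "D * u * q_op = q_op * (D * u)"
    proof -
      have q: "q_op = D + T_op" by (simp add: D_def)
      have "D * u * D = D * (D * u)" by (simp add: mult.assoc u_D)
      then show ?thesis unfolding q distrib_left distrib_right using aa[OF D_T u_T] by simp
    qed
    moreover have "D * u * x_op = x_op * (D * u)" "D * u * y_op = y_op * (D * u)"
      "D * u * h_op = h_op * (D * u)" "D * u * z_op = z_op * (D * u)"
      by (intro cc D_even u_even)+
    moreover have "D * u * E_op = E_op * (D * u)" "D * u * F_op = F_op * (D * u)" "D * u * K_op = K_op * (D * u)"
      by (intro aa D_odd u_odd)+
    ultimately have "\<forall>X\<in>q2_gens 0. D * u * opr X = opr X * (D * u)" "\<forall>X\<in>q2_gens 1. D * u * opr X = opr X * (D * u)"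
      by (simp_all add: q2_gens_def sq2_gens_def)
    then show "D * u * opr X = opr X * (D * u)" if "X \<in> q2_gens p" for p X
      using that by (cases p; metis)
  qed
  then obtain a where a: "D * u = sc a * unit_op" by blast
  have "unit_op * u = u" by (simp add: u_def mult.assoc[symmetric])
  \<comment> \<open>Multiplying \<open>D u = a\<close> by \<open>u\<close> and using
    \<open>u^2 = - c^3\<close> solves for \<open>D\<close>, a multiple of \<open>s w\<close> with
    coefficient \<open>a / c^3\<close>.\<close>
  then have "D * (u * u) = sc a * u" using a by (simp add: mult.assoc[symmetric]) (simp add: mult.assoc)
  moreover have "D * (u * u) = - (sc (c * c * c) * D)"
  proof -
    have "D * (sc (c * c * c) * unit_op) = sc (c * c * c) * D"
      by (simp add: D_def left_diff_distrib right_diff_distrib opr_sc[THEN assoc_rule] T_sc[THEN assoc_rule] mult.assoc)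
    then show ?thesis by (simp add: uu)
  qed
  ultimately have "sc (c * c * c) * D = sc a * (par_op * rel.clif)" by (simp add: u)
  then have "sc (1 / (c * c * c)) * (sc (c * c * c) * D) = sc (a / (c * c * c)) * (par_op * rel.clif)"
    by (simp add: mult.assoc[symmetric])
  then have "D = sc (a / (c * c * c)) * (par_op * rel.clif)"
    using c_nz by (simp add: mult.assoc[symmetric])
  then have "q_op = Z_op (a / (c * c * c))" by (simp add: Z_op_def D_def algebra_simps)
  then show ?thesis by blast
qed

end

section \<open>Extension from \<open>sq\<close> to \<open>q\<close>\<close>

text \<open>Half the trace of the odd block, which is the coefficient of \<open>odd_unit\<close> in
  the decomposition of q as sq plus the line through \<open>odd_unit\<close>; \<open>sqpart\<close>
  is the other component.\<close>

definition trh :: "'k::field_char_0 gl22 \<Rightarrow> 'k" where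
  "trh X = (X $ Inl 1 $ Inr 1 + X $ Inl 2 $ Inr 2) / 2"

definition sqpart :: "'k::field_char_0 gl22 \<Rightarrow> 'k gl22" where
  "sqpart X = X - mscale (trh X) odd_unit"

lemma mscale_zero_left [simp]: "mscale 0 A = 0"
  by (simp add: vec_eq_iff)

lemma trh_block [simp]: "trh (block A B) = (B $ 1 $ 1 + B $ 2 $ 2) / 2"
  by (simp add: trh_def)

lemma sqpart_block [simp]: "sqpart (block A B) = block A (B - mscale ((B $ 1 $ 1 + B $ 2 $ 2) / 2) (mat 1))"
  by (simp add: sqpart_def odd_unit_def)

lemma trh_add: "trh (X + Y) = trh X + trh Y" and trh_mscale: "trh (mscale c X) = c * trh X"
  by (simp_all add: trh_def add_divide_distrib distrib_left)

lemma sqpart_add: "sqpart (X + Y) = sqpart X + sqpart Y" and sqpart_mscale: "sqpart (mscale c X) = mscale c (sqpart X)"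
  by (simp_all add: sqpart_def trh_add trh_mscale vec_eq_iff algebra_simps)

lemma sqpart_sq2: "X \<in> q2 \<Longrightarrow> sqpart X \<in> sq2"
  by (auto simp: in_q2_iff field_simps)

lemma sqpart_id: "X \<in> sq2 \<Longrightarrow> sqpart X = X" and trh_sq2: "X \<in> sq2 \<Longrightarrow> trh X = 0"
  by (auto simp: in_sq2_iff)

lemma sqpart_parity: "X \<in> q2_part p \<Longrightarrow> sqpart X \<in> q2_part p" and trh_even: "X \<in> q2_part 0 \<Longrightarrow> trh X = 0"
  by (elim q2_part_cases; simp)+

lemma q2_part_q2: "X \<in> q2_part p \<Longrightarrow> X \<in> q2"
  by (elim q2_part_cases) simp_all

context typ_smod
begin

lemma opr_even: "opr (block A 0) = sc ((A$1$1 + A$2$2) / 2) * z_op + sc ((A$1$1 - A$2$2) / 2) * h_op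
     + sc (A$1$2) * x_op + sc (A$2$1) * y_op"
proof -
  interpret m: module mscale by (rule module_mscale)
  show ?thesis
    by (subst even_decomp) (simp only: opr_add opr_mscale gens_L m.subspace_add[OF L_subspace] m.subspace_scale[OF L_subspace])
qed

lemma opr_odd:
  assumes "B $ 2 $ 2 = - B $ 1 $ 1"
  shows "opr (block 0 B) = sc (B$1$1) * K_op + sc (B$1$2) * E_op + sc (B$2$1) * F_op"
proof -
  interpret m: module mscale by (rule module_mscale)
  show ?thesis
    by (subst odd_decomp[OF assms]) (simp only: opr_add opr_mscale gens_L m.subspace_add[OF L_subspace] m.subspace_scale[OF L_subspace])
qed

lemma Z_opr_even: "Z_op l * opr (block A 0) = opr (block A 0) * Z_op l"
  unfolding opr_even[of A] distrib_left distrib_right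
  using Z_sc[THEN assoc_rule] by (simp add: mult.assoc Z_commute)

text \<open>\<open>Z_anticommute\<close> is extended linearly from \<open>K\<close>,
  \<open>E\<close>, \<open>F\<close> to all traceless \<open>B\<close>; it reproduces the bracket
  \<open>[M(0, 1), M(0, B)] = M(B, 0) + M(B, 0)\<close>.\<close>

lemma Z_opr_odd:
  assumes "B $ 2 $ 2 = - B $ 1 $ 1"
  shows "Z_op l * opr (block 0 B) + opr (block 0 B) * Z_op l = opr (block B 0) + opr (block B 0)"
proof -
  have *: "Z_op l * (sc a * X) + sc a * X * Z_op l = sc a * (Z_op l * X + X * Z_op l)" for a X
    using Z_sc[THEN assoc_rule, of l a X] by (simp add: mult.assoc distrib_left)
  have "Z_op l * opr (block 0 B) + opr (block 0 B) * Z_op l =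
    (Z_op l * (sc (B$1$1) * K_op) + sc (B$1$1) * K_op * Z_op l) + (Z_op l * (sc (B$1$2) * E_op) + sc (B$1$2) * E_op * Z_op l) +
    (Z_op l * (sc (B$2$1) * F_op) + sc (B$2$1) * F_op * Z_op l)"
    unfolding opr_odd[OF assms] distrib_left distrib_right by (simp only: add_ac)
  also have "\<dots> = opr (block B 0) + opr (block B 0)"
    unfolding * Z_anticommute opr_even[of B] by (simp add: assms distrib_left add_ac del: sc_simps(5))
  finally show ?thesis .
qed

definition ext_op :: "'k \<Rightarrow> 'k gl22 \<Rightarrow> 'v aend" where
  "ext_op l X = opr (sqpart X) + sc (trh X) * Z_op l"

lemma sqpart_L: "X \<in> q2 \<Longrightarrow> sqpart X \<in> L"
  using sqpart_sq2 sq2_subset by blast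

text \<open>The odd block of the bracket is a commutator and so traceless, which reduces the claim
  to the bracket in sq, together with the fact that \<open>Z\<close> commutes with even
  operators.\<close>

lemma ext_op_even:
  assumes "p = 0 \<or> q = 0" "X \<in> q2_part p" "Y \<in> q2_part q"
  shows "ext_op l (sbracket p q X Y) = ext_op l X * ext_op l Y - ext_op l Y * ext_op l X"
proof -
  have XY: "X \<in> q2" "Y \<in> q2" "sqpart X \<in> q2_part p" "sqpart Y \<in> q2_part q"
    using assms q2_part_q2 sqpart_parity by blast+
  have br: "sqpart (sbracket p q X Y) = sbracket p q (sqpart X) (sqpart Y) \<and> trh (sbracket p q X Y) = 0"
    using assms by (auto elim!: q2_part_cases simp: gl2_eq_iff gl2_mult_nth algebra_simps)
  have comm: "sc (trh Y) * (Z_op l * opr (sqpart X)) = sc (trh Y) * (opr (sqpart X) * Z_op l)"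
    "sc (trh X) * (Z_op l * opr (sqpart Y)) = sc (trh X) * (opr (sqpart Y) * Z_op l)"
    "trh X = 0 \<or> trh Y = 0"
    using assms by (auto elim!: q2_part_cases simp: Z_opr_even trh_even)
  have "ext_op l (sbracket p q X Y) = opr (sqpart X) * opr (sqpart Y) - opr (sqpart Y) * opr (sqpart X)"
    using opr_commute[OF sqpart_L[OF XY(1)] XY(3) sqpart_L[OF XY(2)] XY(4) assms(1) refl]
    by (simp add: ext_op_def br)
  also have "\<dots> = ext_op l X * ext_op l Y - ext_op l Y * ext_op l X"
    using comm opr_sc[OF sqpart_L[OF XY(1)], THEN assoc_rule] opr_sc[OF sqpart_L[OF XY(2)], THEN assoc_rule]
    by (auto simp: ext_op_def distrib_left distrib_right mult.assoc)
  finally show ?thesis .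
qed

text \<open>Both arguments are split into a traceless part and a multiple of
  \<open>odd_unit\<close>. The pure sq term is the given action, the two mixed terms are
  \<open>Z_opr_odd\<close>, and the last term, twice a multiple of \<open>Z^2\<close>, is where the
  hypothesis on the square enters.\<close>

lemma ext_op_odd:
  assumes Z: "Z_op l * Z_op l = z_op" and XY: "X \<in> q2_part 1" "Y \<in> q2_part 1"
  shows "ext_op l (sbracket 1 1 X Y) = ext_op l X * ext_op l Y + ext_op l Y * ext_op l X"
proof -
  obtain B D where BD: "X = block 0 B" "Y = block 0 D" using XY by auto
  define b d where "b = trh X" and "d = trh Y"
  define B' D' where "B' = B - mscale b (mat 1)" and "D' = D - mscale d (mat 1)"
  have tr: "B' $ 2 $ 2 = - B' $ 1 $ 1" "D' $ 2 $ 2 = - D' $ 1 $ 1"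
    by (simp_all add: B'_def D'_def b_def d_def BD field_simps)
  have sq: "sqpart X = block 0 B'" "sqpart Y = block 0 D'"
    by (simp_all add: BD B'_def D'_def b_def d_def)
  have L: "block 0 B' \<in> L" "block 0 D' \<in> L" using tr sq2_subset by auto
  have sbr: "sbracket 1 1 X Y = sbracket 1 1 (block 0 B') (block 0 D')
      + (mscale d (block B' 0) + mscale d (block B' 0)) + (mscale b (block D' 0) + mscale b (block D' 0))
      + (mscale (b * d) (H 1 + H 2) + mscale (b * d) (H 1 + H 2))"
    by (simp add: BD B'_def D'_def elements gl2_eq_iff gl2_mult_nth algebra_simps)
  interpret m: module mscale by (rule module_mscale)
  have brL: "sbracket 1 1 (block 0 B') (block 0 D') \<in> L"
    using L_sbracket[OF L(1) _ L(2)] by simp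
  have "ext_op l (sbracket 1 1 X Y) = opr (sbracket 1 1 X Y)"
    by (simp add: ext_op_def BD)
  also have "\<dots> = opr (sbracket 1 1 (block 0 B') (block 0 D'))
      + (sc d * opr (block B' 0) + sc d * opr (block B' 0)) + (sc b * opr (block D' 0) + sc b * opr (block D' 0))
      + (sc (b * d) * z_op + sc (b * d) * z_op)"
    unfolding sbr by (simp only: opr_add opr_mscale gens_L brL m.subspace_add[OF L_subspace] m.subspace_scale[OF L_subspace])
  also have "\<dots> = (opr (block 0 B') * opr (block 0 D') + opr (block 0 D') * opr (block 0 B'))
      + sc d * (Z_op l * opr (block 0 B') + opr (block 0 B') * Z_op l) + sc b * (Z_op l * opr (block 0 D') + opr (block 0 D') * Z_op l)
      + (sc (b * d) * z_op + sc (b * d) * z_op)"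
    using opr_anticommute[OF L(1) _ L(2) _ refl] unfolding Z_opr_odd[OF tr(1)] Z_opr_odd[OF tr(2)]
    by (simp add: distrib_left del: sbracket_odd)
  also have "\<dots> = ext_op l X * ext_op l Y + ext_op l Y * ext_op l X"
  proof -
    have ZZ: "sc a * Z_op l * (sc a' * Z_op l) = sc (a * a') * z_op" for a a'
      using Z_sc[THEN assoc_rule, of l a' "Z_op l"] by (simp add: mult.assoc Z) (simp add: mult.assoc[symmetric])
    show ?thesis
      using opr_sc[OF L(1), THEN assoc_rule] opr_sc[OF L(2), THEN assoc_rule]
      by (simp add: ext_op_def sq b_def[symmetric] d_def[symmetric] distrib_left distrib_right ZZ mult.commute[of d b])
        (simp add: algebra_simps del: sc_simps(5))
  qed
  finally show ?thesis .
qed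

definition ext :: "'k \<Rightarrow> ('k, 'v) supermod" where
  "ext l = V\<lparr>act := \<lambda>X v. act V (sqpart X) v + scl (trh X) (ap (Z_op l) v)\<rparr>"

lemma ext_comp [simp]: "comp (ext l) = comp V"
  by (simp add: ext_def)

lemma ext_carr [simp]: "carr (ext l) = carr V"
  by (simp add: carr_def)

lemma act_ext: "act (ext l) X v = act V (sqpart X) v + scl (trh X) (ap (Z_op l) v)"
  by (simp add: ext_def)

lemma act_ext_sq2: "X \<in> sq2 \<Longrightarrow> act (ext l) X v = act V X v"
  by (simp add: act_ext sqpart_id trh_sq2)

lemma Z_carr: "v \<in> carr V \<Longrightarrow> ap (Z_op l) v \<in> carr V"
  using unit_carr[of "ap (Z_op l) v"] Z_unit(2)[of l] by (metis ap_simps(5))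

lemma Z_scl: "ap (Z_op l) (scl a v) = scl a (ap (Z_op l) v)"
  using arg_cong[OF Z_sc[of l a], of "\<lambda>f. ap f v"] by simp

lemma act_ext_op: "X \<in> q2 \<Longrightarrow> v \<in> carr V \<Longrightarrow> act (ext l) X v = ap (ext_op l X) v"
  by (simp add: act_ext ext_op_def sqpart_L)

lemma ext_op_carr: "X \<in> q2 \<Longrightarrow> v \<in> carr V \<Longrightarrow> ap (ext_op l X) v \<in> carr V"
  by (simp add: ext_op_def sqpart_L act_carr Z_carr subspace_add[OF carr_subspace] subspace_scale[OF carr_subspace])

lemma supermodule_ext:
  assumes Z: "Z_op l * Z_op l = z_op"
  shows "supermodule scl q2 (ext l)"
  unfolding supermodule_def
proof (intro conjI allI ballI)
  fix i show "subspace (comp (ext l) i)" by (simp add: comp_subspace)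
next
  show "comp (ext l) 0 \<inter> comp (ext l) 1 = {0}" using comp_inter by simp
next
  fix X :: "'k gl22" assume X: "X \<in> q2"
  have "act (ext l) X (u + v) = act (ext l) X u + act (ext l) X v" if "u \<in> carr V" "v \<in> carr V" for u v
    using that by (simp add: act_ext act_add[OF sqpart_L[OF X]] scale_right_distrib)
  moreover have "act (ext l) X (scl a v) = scl a (act (ext l) X v)" if "v \<in> carr V" for a v
    using that by (simp add: act_ext act_scl[OF sqpart_L[OF X]] Z_scl scale_right_distrib mult.commute)
  ultimately show "linear_on_carr scl (carr (ext l)) (act (ext l) X)"
    by (simp add: linear_on_carr_def)
next
  fix X Y :: "'k gl22" and v assume "X \<in> q2" "Y \<in> q2" "v \<in> carr (ext l)"
  then show "act (ext l) (X + Y) v = act (ext l) X v + act (ext l) Y v"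
    by (simp add: act_ext sqpart_add trh_add act_add_left sqpart_L scale_left_distrib add_ac)
next
  fix a and X :: "'k gl22" and v assume "X \<in> q2" "v \<in> carr (ext l)"
  then show "act (ext l) (mscale a X) v = scl a (act (ext l) X v)"
    by (simp add: act_ext sqpart_mscale trh_mscale act_mscale sqpart_L scale_right_distrib)
next
  fix p i and X :: "'k gl22" and v assume X: "X \<in> q2 \<inter> q2_part p" and v: "v \<in> comp (ext l) i"
  have "act V (sqpart X) v \<in> comp V (p + i)"
    using X v by (intro act_comp sqpart_L sqpart_parity) auto
  moreover have "scl (trh X) (ap (Z_op l) v) \<in> comp V (p + i)"
  proof (cases "p = 0")
    case True
    then have "trh X = 0" using X by (intro trh_even) (simp del: q2_part_0)
    then show ?thesis using comp_0 by simp
  next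
    case False
    then show ?thesis using Z_comp[of v i l] v by (cases i) (simp_all add: subspace_scale[OF comp_subspace])
  qed
  ultimately show "act (ext l) X v \<in> comp (ext l) (p + i)"
    by (simp only: act_ext ext_comp subspace_add[OF comp_subspace])
next
  fix p q and X Y :: "'k gl22" and v assume XY: "X \<in> q2 \<inter> q2_part p" "Y \<in> q2 \<inter> q2_part q" and "v \<in> carr (ext l)"
  then have v: "v \<in> carr V" by simp
  have "sbracket p q X Y \<in> q2"
    using XY subsuperalgebra_q2 unfolding subsuperalgebra_def by blast
  moreover have "ext_op l (sbracket p q X Y) = ext_op l X * ext_op l Y - sc (ksign p q) * (ext_op l Y * ext_op l X)"
  proof (cases "p = 0 \<or> q = 0")
    case True
    then show ?thesis using ext_op_even XY by (auto simp: ksign_def)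
  next
    case False
    then show ?thesis using ext_op_odd[OF Z, of X Y] XY by (auto simp: ksign_def)
  qed
  ultimately show "act (ext l) (sbracket p q X Y) v =
      act (ext l) X (act (ext l) Y v) - scl (ksign p q) (act (ext l) Y (act (ext l) X v))"
    using XY v by (simp add: act_ext_op ext_op_carr)
qed

end

section \<open>Isomorphisms\<close>

lemma carr_parity_change [simp]: "carr (parity_change V) = carr V"
  unfolding carr_def parity_change_def by (force simp: add.commute)

lemma comp_parity_change [simp]: "comp (parity_change V) i = comp V (i + 1)"
  by (simp add: parity_change_def)

lemma act_parity_change [simp]: "act (parity_change V) = act V"
  by (simp add: parity_change_def)

lemma parity_change_twice [simp]: "parity_change (parity_change V) = V"
proof -
  have "i + 1 + 1 = i" for i :: bit by (cases i) simp_all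
  then show ?thesis by (simp add: parity_change_def)
qed

lemma comp_res [simp]: "comp (res L V) = comp V"
  by (simp add: res_def)

lemma carr_res [simp]: "carr (res L V) = carr V"
  by (simp add: carr_def)

lemma act_res: "X \<in> L \<Longrightarrow> act (res L V) X = act V X"
  by (simp add: res_def)

lemma isomorphicI:
  assumes "bij_betw f (carr V) (carr W)" "linear_on_carr scl (carr V) f" "\<And>i v. v \<in> comp V i \<Longrightarrow> f v \<in> comp W i"
    "\<And>X v. X \<in> L \<Longrightarrow> v \<in> carr V \<Longrightarrow> f (act V X v) = act W X (f v)"
  shows "isomorphic scl L V W"
  unfolding isomorphic_def using assms by (intro exI[of _ f] conjI allI ballI image_subsetI) simp_all

lemma isomorphicE:
  assumes "isomorphic scl L V W"
  obtains f where "bij_betw f (carr V) (carr W)" "linear_on_carr scl (carr V) f"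
    "\<And>i v. v \<in> comp V i \<Longrightarrow> f v \<in> comp W i"
    "\<And>X v. X \<in> L \<Longrightarrow> v \<in> carr V \<Longrightarrow> f (act V X v) = act W X (f v)"
proof -
  from assms obtain f where f: "bij_betw f (carr V) (carr W) \<and> linear_on_carr scl (carr V) f \<and>
    (\<forall>i. f ` comp V i \<subseteq> comp W i) \<and> (\<forall>X\<in>L. \<forall>v\<in>carr V. f (act V X v) = act W X (f v))"
    unfolding isomorphic_def by (rule exE)
  then have "\<And>i v. v \<in> comp V i \<Longrightarrow> f v \<in> comp W i" by blast
  with f show ?thesis by (intro that[of f]) simp_all
qed

lemma isomorphic_refl: "isomorphic scl L V V"
  by (rule isomorphicI[of "\<lambda>v. v"]) (simp_all add: linear_on_carr_def bij_betw_def)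

lemma isomorphic_trans:
  assumes "isomorphic scl L V W" "isomorphic scl L W U"
  shows "isomorphic scl L V U"
proof -
  obtain f where f: "bij_betw f (carr V) (carr W)" "linear_on_carr scl (carr V) f" "\<And>i v. v \<in> comp V i \<Longrightarrow> f v \<in> comp W i"
    "\<And>X v. X \<in> L \<Longrightarrow> v \<in> carr V \<Longrightarrow> f (act V X v) = act W X (f v)"
    using assms(1) by (rule isomorphicE) blast
  obtain g where g: "bij_betw g (carr W) (carr U)" "linear_on_carr scl (carr W) g" "\<And>i v. v \<in> comp W i \<Longrightarrow> g v \<in> comp U i"
    "\<And>X v. X \<in> L \<Longrightarrow> v \<in> carr W \<Longrightarrow> g (act W X v) = act U X (g v)"
    using assms(2) by (rule isomorphicE) blast
  have fW: "f v \<in> carr W" if "v \<in> carr V" for v using f(1) that by (auto simp: bij_betw_def)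
  show ?thesis
  proof (rule isomorphicI)
    show "bij_betw (g \<circ> f) (carr V) (carr U)" using bij_betw_trans[OF f(1) g(1)] .
    show "linear_on_carr scl (carr V) (g \<circ> f)"
      using f(2) g(2) fW by (simp add: linear_on_carr_def)
    show "(g \<circ> f) v \<in> comp U i" if "v \<in> comp V i" for v i
      using g(3)[OF f(3)[OF that]] by simp
    show "(g \<circ> f) (act V X v) = act U X ((g \<circ> f) v)" if "X \<in> L" "v \<in> carr V" for X v
      using that by (simp add: f g fW)
  qed
qed

lemma isomorphic_parity:
  assumes "isomorphic scl L V W"
  shows "isomorphic scl L (parity_change V) (parity_change W)"
  using assms by (rule isomorphicE) (rule isomorphicI; simp only: carr_parity_change comp_parity_change act_parity_change)

text \<open>An isomorphism is only required to map components into components. The inverse does so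
  as well, because the image of a homogeneous decomposition is the unique decomposition of the
  image.\<close>

lemma isomorphic_sym:
  assumes "smod scl L V" "smod scl L W" "isomorphic scl L V W"
  shows "isomorphic scl L W V"
proof -
  interpret V: smod scl L V by fact
  interpret W: smod scl L W by fact
  obtain f where f: "bij_betw f (carr V) (carr W)" "linear_on_carr scl (carr V) f" "\<And>i v. v \<in> comp V i \<Longrightarrow> f v \<in> comp W i"
    "\<And>X v. X \<in> L \<Longrightarrow> v \<in> carr V \<Longrightarrow> f (act V X v) = act W X (f v)"
    using assms(3) by (rule isomorphicE) blast
  have fadd: "f (u + v) = f u + f v" if "u \<in> carr V" "v \<in> carr V" for u v
    using f(2) that by (simp add: linear_on_carr_def)
  have fscl: "f (scl a u) = scl a (f u)" if "u \<in> carr V" for a u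
    using f(2) that by (simp add: linear_on_carr_def)
  have f0: "f 0 = 0" using fscl[OF V.comp_carr[OF V.comp_0], of 0] by simp
  have inj: "u = v" if "u \<in> carr V" "v \<in> carr V" "f u = f v" for u v
    using f(1) that by (auto simp: bij_betw_def inj_on_def)
  define g where "g = inv_into (carr V) f"
  have g: "bij_betw g (carr W) (carr V)" unfolding g_def by (rule bij_betw_inv_into[OF f(1)])
  have gV: "g w \<in> carr V" and fg: "f (g w) = w" if "w \<in> carr W" for w
    using that g f(1) by (auto simp: bij_betw_def g_def f_inv_into_f)
  note closed = V.subspace_add[OF V.carr_subspace] V.subspace_scale[OF V.carr_subspace] V.act_carr
    V.subspace_add[OF W.carr_subspace] V.subspace_scale[OF W.carr_subspace] W.act_carr
  have "g w \<in> comp V i" if w: "w \<in> comp W i" for w i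
  proof -
    have wc: "w \<in> carr W" using w by (rule W.comp_carr)
    obtain v0 v1 where v: "v0 \<in> comp V 0" "v1 \<in> comp V 1" "g w = v0 + v1" by (rule V.carrE[OF gV[OF wc]])
    have fv: "f v0 \<in> comp W 0" "f v1 \<in> comp W 1" using f(3) v by simp_all
    have sum: "f v0 + f v1 = w" using fg[OF wc] v by (simp add: fadd V.comp_carr)
    show ?thesis
    proof (cases i)
      case zero
      then have "f v1 = 0" using W.carr_unique[OF fv, of w 0] w sum W.comp_0 by simp
      then have "v1 = 0" using inj[of v1 0] v f0 V.comp_0 V.comp_carr by metis
      then show ?thesis using v zero by simp
    next
      case one
      then have "f v0 = 0" using W.carr_unique[OF fv, of 0 w] w sum W.comp_0 by simp
      then have "v0 = 0" using inj[of v0 0] v f0 V.comp_0 V.comp_carr by metis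
      then show ?thesis using v one by simp
    qed
  qed
  moreover have "g (u + w) = g u + g w" if "u \<in> carr W" "w \<in> carr W" for u w
    by (rule inj) (use that in \<open>simp_all add: gV fg fadd closed\<close>)
  moreover have "g (scl a w) = scl a (g w)" if "w \<in> carr W" for a w
    by (rule inj) (use that in \<open>simp_all add: gV fg fscl closed\<close>)
  moreover have "g (act W X w) = act V X (g w)" if "X \<in> L" "w \<in> carr W" for X w
    by (rule inj) (use that in \<open>simp_all add: gV fg f(4) closed\<close>)
  ultimately show ?thesis
    using g by (intro isomorphicI[of g]) (simp_all add: linear_on_carr_def)
qed

lemma simple_typical_smod:
  assumes "vector_space scl" "subsuperalgebra L" "V \<in> simple_typical scl L"
  shows "smod scl L V"
  using assms by (simp add: smod_def smod_axioms_def simple_typical_def simple_supermodule_def)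

lemma smod_parity_change:
  assumes "smod scl L V" shows "smod scl L (parity_change V)"
proof -
  interpret smod scl L V by fact
  have comm: "act V X v \<in> comp V (p + i + 1)" if "X \<in> L" "X \<in> q2_part p" "v \<in> comp V (i + 1)" for X p v i
    using act_comp[OF that] by (simp only: add.assoc)
  have "supermodule scl L (parity_change V)"
    unfolding supermodule_def carr_parity_change comp_parity_change act_parity_change
    using supermodule comm unfolding supermodule_def by (simp add: Int_commute del: q2_part_0 q2_part_1)
  then show ?thesis using smod_axioms by (simp add: smod_def smod_axioms_def)
qed

lemma equiv_iso_up_to_parity:
  assumes "vector_space scl" "subsuperalgebra L"
  shows "equiv (simple_typical scl L) (iso_up_to_parity scl L)"
proof (rule equivI)
  note sm = simple_typical_smod[OF assms]
  show "iso_up_to_parity scl L \<subseteq> simple_typical scl L \<times> simple_typical scl L"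
    by (auto simp: iso_up_to_parity_def)
  show "refl_on (simple_typical scl L) (iso_up_to_parity scl L)"
    by (auto simp: refl_on_def iso_up_to_parity_def isomorphic_refl)
  show "sym (iso_up_to_parity scl L)"
  proof (rule symI)
    fix V W assume VW: "(V, W) \<in> iso_up_to_parity scl L"
    then have s: "smod scl L V" "smod scl L W" by (auto simp: iso_up_to_parity_def sm)
    have "isomorphic scl L W V \<or> isomorphic scl L W (parity_change V)"
      using VW isomorphic_sym[OF s] isomorphic_sym[OF s(1) smod_parity_change[OF s(2)]]
        isomorphic_parity[of scl L "parity_change W" V] by (auto simp: iso_up_to_parity_def)
    with VW show "(W, V) \<in> iso_up_to_parity scl L" by (auto simp: iso_up_to_parity_def)
  qed
  show "trans (iso_up_to_parity scl L)"
  proof (rule transI)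
    fix V W U assume VW: "(V, W) \<in> iso_up_to_parity scl L" "(W, U) \<in> iso_up_to_parity scl L"
    then have 1: "isomorphic scl L V W \<or> isomorphic scl L V (parity_change W)"
      and 2: "isomorphic scl L W U \<or> isomorphic scl L W (parity_change U)"
      by (simp_all add: iso_up_to_parity_def)
    from 2 have 3: "isomorphic scl L (parity_change W) (parity_change U) \<or> isomorphic scl L (parity_change W) U"
      using isomorphic_parity[of scl L W] by force
    have "isomorphic scl L V U \<or> isomorphic scl L V (parity_change U)"
      using 1 2 3 by (elim disjE) (blast dest: isomorphic_trans)+
    with VW show "(V, U) \<in> iso_up_to_parity scl L" by (auto simp: iso_up_to_parity_def)
  qed
qed

text \<open>One direction of \<open>rs\<close> makes the induced map well defined and the other
  makes it injective; surjectivity is needed only up to \<open>s\<close>.\<close>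

lemma bij_betw_quotient_map:
  assumes r: "equiv A r" and s: "equiv B s" and f: "f ` A \<subseteq> B"
    and rs: "\<And>a a'. a \<in> A \<Longrightarrow> a' \<in> A \<Longrightarrow> (a, a') \<in> r \<longleftrightarrow> (f a, f a') \<in> s"
    and surj: "\<And>b. b \<in> B \<Longrightarrow> \<exists>a\<in>A. (f a, b) \<in> s"
  shows "(\<lambda>a. s `` {f a}) respects r" "bij_betw (\<lambda>C. \<Union>a\<in>C. s `` {f a}) (A // r) (B // s)"
proof -
  show resp: "(\<lambda>a. s `` {f a}) respects r"
  proof (rule congruentI)
    fix a a' assume "(a, a') \<in> r"
    moreover from this have "a \<in> A" "a' \<in> A" using r by (auto simp: equiv_def)
    ultimately show "s `` {f a} = s `` {f a'}" using rs equiv_class_eq[OF s] by blast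
  qed
  let ?g = "\<lambda>C. \<Union>a\<in>C. s `` {f a}"
  have g: "?g (r `` {a}) = s `` {f a}" if "a \<in> A" for a
    by (rule UN_equiv_class[OF r resp that])
  show "bij_betw ?g (A // r) (B // s)"
    unfolding bij_betw_def
  proof
    show "inj_on ?g (A // r)"
    proof (rule inj_onI)
      fix C D assume CD: "C \<in> A // r" "D \<in> A // r" "?g C = ?g D"
      obtain a where a: "a \<in> A" "C = r `` {a}" using CD(1) by (rule quotientE)
      obtain b where b: "b \<in> A" "D = r `` {b}" using CD(2) by (rule quotientE)
      have "s `` {f a} = s `` {f b}" using CD(3) unfolding a(2) b(2) g[OF a(1)] g[OF b(1)] .
      then have "(f a, f b) \<in> s" using eq_equiv_class_iff[OF s] a b f by blast
      then have "(a, b) \<in> r" using rs a b by blast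
      then show "C = D" using equiv_class_eq[OF r] a b by blast
    qed
    show "?g ` (A // r) = B // s"
    proof (intro equalityI subsetI)
      fix D assume "D \<in> ?g ` (A // r)"
      then obtain C where C: "C \<in> A // r" "D = ?g C" by blast
      obtain a where a: "a \<in> A" "C = r `` {a}" using C(1) by (rule quotientE)
      have "f a \<in> B" using f a(1) by blast
      then show "D \<in> B // s" unfolding C(2) a(2) g[OF a(1)] by (rule quotientI)
    next
      fix D assume "D \<in> B // s"
      then obtain b where b: "b \<in> B" "D = s `` {b}" by (rule quotientE)
      obtain a where a: "a \<in> A" "(f a, b) \<in> s" using surj[OF b(1)] by blast
      have "D = s `` {f a}" using equiv_class_eq[OF s a(2)] b(2) by simp
      then have "D = ?g (r `` {a})" using g[OF a(1)] by simp
      then show "D \<in> ?g ` (A // r)" by (rule image_eqI) (rule quotientI[OF a(1)])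
    qed
  qed
qed

section \<open>Restriction\<close>

lemma sq2_q2: "X \<in> sq2 \<Longrightarrow> X \<in> q2"
  by (auto simp: in_sq2_iff)

lemma simple_typical_q_simple:
  fixes scl :: "'k::{alg_closed_field, field_char_0} \<Rightarrow> 'v::ab_group_add \<Rightarrow> 'v"
  assumes "uncountable (UNIV :: 'k set)" "vector_space scl" and V: "V \<in> simple_typical scl q2"
  obtains c where "q_simple scl V c"
proof -
  have s: "smod scl q2 V" by (rule simple_typical_smod[OF assms(2) subsuperalgebra_q2 V])
  obtain c where c: "c \<noteq> 0" "\<forall>v\<in>carr V. act V (H 1 + H 2) v = scl c v"
    using V by (auto simp: simple_typical_def typical_def)
  have "q_simple scl V c"
    using s c assms sq2_q2 generating_q2
    by (intro q_simple.intro simple_typ.intro simple_smod.intro simple_smod_axioms.intro typ_smod.intro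
        sq_smod.intro sq_smod_axioms.intro typ_smod_axioms.intro subsetI) (simp_all add: simple_typical_def)
  then show ?thesis by (rule that)
qed

lemma simple_typical_sq_simple:
  fixes scl :: "'k::{alg_closed_field, field_char_0} \<Rightarrow> 'v::ab_group_add \<Rightarrow> 'v"
  assumes "uncountable (UNIV :: 'k set)" "vector_space scl" and V: "V \<in> simple_typical scl sq2"
  obtains c where "sq_simple scl V c"
proof -
  have s: "smod scl sq2 V" by (rule simple_typical_smod[OF assms(2) subsuperalgebra_sq2 V])
  obtain c where c: "c \<noteq> 0" "\<forall>v\<in>carr V. act V (H 1 + H 2) v = scl c v"
    using V by (auto simp: simple_typical_def typical_def)
  have "sq_simple scl V c"
    using s c assms generating_sq2
    by (intro sq_simple.intro simple_typ.intro simple_smod.intro simple_smod_axioms.intro typ_smod.intro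
        sq_smod.intro sq_smod_axioms.intro typ_smod_axioms.intro) (simp_all add: simple_typical_def)
  then show ?thesis by (rule that)
qed

lemma subsupermoduleD:
  assumes "subsupermodule scl L V N" "X \<in> L" "X \<in> q2_part p" "v \<in> N i"
  shows "act V X v \<in> N (p + i)"
proof -
  have "\<forall>p i. \<forall>X\<in>L \<inter> q2_part p. \<forall>v\<in>N i. act V X v \<in> N (p + i)"
    using assms(1) unfolding subsupermodule_def by (rule conjunct2)
  then show ?thesis using assms(2-4) by blast
qed

lemma (in sq_smod) supermodule_res: "supermodule scl sq2 (res sq2 V)"
proof -
  have sub: "X \<in> sq2 \<Longrightarrow> X \<in> L" for X using sq2_subset by blast
  have closed: "X \<in> sq2 \<Longrightarrow> Y \<in> sq2 \<Longrightarrow> X + Y \<in> sq2" "X \<in> sq2 \<Longrightarrow> mscale a X \<in> sq2"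
    and br: "X \<in> sq2 \<Longrightarrow> X \<in> q2_part p \<Longrightarrow> Y \<in> sq2 \<Longrightarrow> Y \<in> q2_part q \<Longrightarrow> sbracket p q X Y \<in> sq2" for a X Y p q
  proof -
    show "X + Y \<in> sq2" if "X \<in> sq2" "Y \<in> sq2" using that by (auto simp: in_sq2_iff)
    show "mscale a X \<in> sq2" if "X \<in> sq2" using that by (auto simp: in_sq2_iff)
    show "sbracket p q X Y \<in> sq2" if "X \<in> sq2" "X \<in> q2_part p" "Y \<in> sq2" "Y \<in> q2_part q"
      using subsuperalgebra_sq2 that unfolding subsuperalgebra_def by blast
  qed
  show ?thesis
    unfolding supermodule_def comp_res carr_res
  proof (intro conjI allI ballI)
    show "act (res sq2 V) X v \<in> comp V (p + i)" if "X \<in> sq2 \<inter> q2_part p" "v \<in> comp V i" for p i X v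
      using that act_comp[of X p v i] sub by (simp only: act_res IntD1[OF that(1)] IntD2[OF that(1)])
    show "act (res sq2 V) (sbracket p q X Y) v =
        act (res sq2 V) X (act (res sq2 V) Y v) - scl (ksign p q) (act (res sq2 V) Y (act (res sq2 V) X v))"
      if "X \<in> sq2 \<inter> q2_part p" "Y \<in> sq2 \<inter> q2_part q" "v \<in> carr V" for p q X Y v
      using that by (simp add: act_res sub br act_sbracket del: q2_part_0 q2_part_1)
  qed (simp_all add: act_res sub closed comp_subspace comp_inter act_linear act_add_left act_mscale)
qed

context q_simple
begin

text \<open>On \<open>V\<close> the element \<open>odd_unit\<close> acts as some
  \<open>T + l s w\<close>. Here \<open>T\<close> and \<open>w\<close> preserve \<open>N\<close>
  since they come from the enveloping algebra of sq, and \<open>s\<close> preserves it since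
  \<open>N\<close> is graded.\<close>

lemma subsupermodule_res:
  assumes "subsupermodule scl sq2 (res sq2 V) N"
  shows "subsupermodule scl q2 V N"
proof (rule subsupermodule_generating[OF generating])
  show N: "subspace (N i)" "N i \<subseteq> comp V i" for i
    using assms by (simp_all add: subsupermodule_def)
  have GN: "act V X v \<in> N (p + i)" if "X \<in> sq2_gens p" "v \<in> N i" for p i X v
  proof -
    have X: "X \<in> sq2" "X \<in> q2_part p" using that(1) generating_sq2 unfolding generating_def by blast+
    show ?thesis using subsupermoduleD[OF assms X that(2)] unfolding act_res[OF X(1)] .
  qed
  obtain l where l: "q_op = Z_op l" using q_op_eq by blast
  have odd_unit: "act V odd_unit v \<in> N (1 + i)" if v: "v \<in> N i" for i v
  proof -
    have vc: "v \<in> carr V" using v N(2) comp_carr by blast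
    have w: "ap rel.clif v \<in> N (i + 1)" "ap rel.ocas v \<in> N (i + 1)"
      using sq2_gens_stable[of N, OF N GN v] by blast+
    have "ap par_op (ap rel.clif v) \<in> N (i + 1)"
      using w(1) subspace_neg[OF N(1) w(1)] unfolding par_comp[OF subsetD[OF N(2) w(1)]]
      by (cases "i + 1 = 0") (simp_all only: refl if_True if_False)
    then have "ap (Z_op l) v \<in> N (i + 1)"
      using w by (simp only: Z_op_def T_op_def ap_simps ap_sc subspace_add[OF N(1)] subspace_scale[OF N(1)])
    moreover have "act V odd_unit v = ap (Z_op l) v"
      unfolding l[symmetric] using vc by simp
    ultimately show ?thesis by (simp only: add.commute)
  qed
  show "act V X v \<in> N (p + i)" if "X \<in> q2_gens p" "v \<in> N i" for p i X v
  proof (cases "p = 1 \<and> X = odd_unit")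
    case True
    then show ?thesis using odd_unit[OF that(2)] by simp
  next
    case False
    then have "X \<in> sq2_gens p" using that(1) by (cases p) (auto simp: q2_gens_def)
    then show ?thesis using GN that(2) by blast
  qed
qed

lemma res_simple_typical: "res sq2 V \<in> simple_typical scl sq2"
proof -
  have "H 1 + H 2 \<in> (sq2 :: 'k gl22 set)" by (simp add: elements)
  then have "typical scl (res sq2 V)"
    using central c_nz by (auto simp: typical_def act_res)
  moreover have "simple_supermodule scl sq2 (res sq2 V)"
    using simple subsupermodule_res supermodule_res by (simp add: simple_supermodule_def)
  ultimately show ?thesis by (simp add: simple_typical_def)
qed

end

context sq_simple
begin

text \<open>A graded subsupermodule of the extension is also one for sq, so simplicity passes from
  \<open>V\<close> to the extension.\<close>

lemma ext_simple_typical: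
  assumes "Z_op l * Z_op l = z_op"
  shows "ext l \<in> simple_typical scl q2"
proof -
  have "subsupermodule scl sq2 V N" if "subsupermodule scl q2 (ext l) N" for N
  proof -
    have "act V X v \<in> N (p + i)" if "X \<in> sq2 \<inter> q2_part p" "v \<in> N i" for p i X v
      using subsupermoduleD[OF \<open>subsupermodule scl q2 (ext l) N\<close> sq2_q2[OF IntD1[OF that(1)]] IntD2[OF that(1)] that(2)]
      unfolding act_ext_sq2[OF IntD1[OF that(1)]] .
    with that show ?thesis unfolding subsupermodule_def ext_comp by blast
  qed
  then have "simple_supermodule scl q2 (ext l)"
    using simple supermodule_ext[OF assms] by (simp add: simple_supermodule_def)
  moreover have "H 1 + H 2 \<in> (sq2 :: 'k gl22 set)" by (simp add: elements)
  then have "typical scl (ext l)"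
    using central c_nz by (auto simp: typical_def act_ext_sq2)
  ultimately show ?thesis by (simp add: simple_typical_def)
qed

lemma ex_extension: "\<exists>U\<in>simple_typical scl q2. isomorphic scl sq2 (res sq2 U) V"
proof -
  obtain l where l: "Z_op l * Z_op l = z_op" using ex_Z_square by blast
  \<comment> \<open>The identity map serves as isomorphism; equality may fail because
    \<open>res\<close> alters the action outside \<open>sq2\<close>.\<close>
  have "isomorphic scl sq2 (res sq2 (ext l)) V"
    by (rule isomorphicI[of "\<lambda>v. v"]) (simp_all add: linear_on_carr_def bij_betw_def act_res act_ext_sq2)
  then show ?thesis using ext_simple_typical[OF l] by blast
qed

end

section \<open>Uniqueness of the extension\<close>

context typ_smod
begin

lemma clif_carr: "v \<in> carr V \<Longrightarrow> ap rel.clif v \<in> carr V"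
  using unit_carr[of "ap rel.clif v"] clif_unit(2) by (metis ap_simps(5))

lemma clif_scl: "ap rel.clif (scl a v) = scl a (ap rel.clif v)"
  using arg_cong[OF sc_clif[of a], of "\<lambda>f. ap f v"] by simp

lemma clif_clif: "v \<in> carr V \<Longrightarrow> ap rel.clif (ap rel.clif v) = scl (c * c * c) v"
  using arg_cong[OF clif_square, of "\<lambda>f. ap f v"] by (simp add: unit_id)

lemma clif_bij: "bij_betw (ap rel.clif) (carr V) (carr V)"
proof (rule bij_betw_byWitness[where f' = "\<lambda>v. scl (1 / (c * c * c)) (ap rel.clif v)"])
qed (use c_nz in \<open>auto simp: clif_clif clif_scl clif_carr subspace_scale[OF carr_subspace]\<close>)

lemma clif_sq2:
  assumes "X \<in> sq2" "v \<in> carr V"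
  shows "ap rel.clif (act V X v) = act V X (ap rel.clif v)"
proof -
  obtain A B where X: "X = block A 0 + block 0 B" "B $ 2 $ 2 = - B $ 1 $ 1"
    using assms(1) unfolding in_sq2_iff by force
  have AB: "block A 0 \<in> L" "block 0 B \<in> L" using X(2) sq2_subset by auto
  have "rel.clif * opr (block A 0) = opr (block A 0) * rel.clif"
    unfolding opr_even[of A] distrib_left distrib_right
    using sc_clif[THEN assoc_rule] by (simp add: mult.assoc rel.clif_commute)
  moreover have "rel.clif * opr (block 0 B) = opr (block 0 B) * rel.clif"
    unfolding opr_odd[OF X(2)] distrib_left distrib_right
    using sc_clif[THEN assoc_rule] by (simp add: mult.assoc rel.clif_commute)
  ultimately have "rel.clif * opr X = opr X * rel.clif"
    unfolding X(1) opr_add[OF AB] distrib_left distrib_right by simp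
  from arg_cong[OF this, of "\<lambda>f. ap f v"] show ?thesis
    using assms sq2_subset by (simp add: clif_carr subsetD)
qed

end

text \<open>An isomorphism \<open>f\<close> between the restrictions of two simple typical
  q-supermodules with the same central scalar.\<close>

locale sq_hom = V: q_simple scl V c + W: q_simple scl W c
  for scl :: "'k::{alg_closed_field, field_char_0} \<Rightarrow> 'v::ab_group_add \<Rightarrow> 'v" and V W c +
  fixes f
  assumes bij: "bij_betw f (carr V) (carr W)" and lin: "linear_on_carr scl (carr V) f"
    and comp: "\<And>i v. v \<in> comp V i \<Longrightarrow> f v \<in> comp W i"
    and hom: "\<And>X v. X \<in> sq2 \<Longrightarrow> v \<in> carr V \<Longrightarrow> f (act V X v) = act W X (f v)"
begin

lemma f_add: "u \<in> carr V \<Longrightarrow> v \<in> carr V \<Longrightarrow> f (u + v) = f u + f v"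
  and f_scl: "v \<in> carr V \<Longrightarrow> f (scl a v) = scl a (f v)"
  using lin by (simp_all add: linear_on_carr_def)

lemma f_diff: "u \<in> carr V \<Longrightarrow> v \<in> carr V \<Longrightarrow> f (u - v) = f u - f v"
  using f_add[of u "scl (- 1) v"] f_scl[of v "- 1"] V.subspace_scale[OF V.carr_subspace, of v "- 1"] by simp

lemma f_carr: "v \<in> carr V \<Longrightarrow> f v \<in> carr W"
  using bij by (auto simp: bij_betw_def)

text \<open>A correspondence of operators that is stable under the ring operations, so that it
  passes from generators, scalars and parity operators to \<open>T\<close> and
  \<open>Z\<close>.\<close>

definition intertwines :: "'v aend \<Rightarrow> 'v aend \<Rightarrow> bool" where
  "intertwines a b \<longleftrightarrow> (\<forall>v\<in>carr V. ap a v \<in> carr V \<and> f (ap a v) = ap b (f v))"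

lemma intertwines_ring:
  assumes "intertwines a b" "intertwines a' b'"
  shows "intertwines (a + a') (b + b')" "intertwines (a - a') (b - b')" "intertwines (a * a') (b * b')"
  using assms by (auto simp: intertwines_def f_add f_diff V.subspace_add[OF V.carr_subspace] V.subspace_diff[OF V.carr_subspace])

lemma intertwines_sc: "intertwines (V.sc a) (V.sc a)"
  by (simp add: intertwines_def f_scl V.subspace_scale[OF V.carr_subspace])

lemma intertwines_opr: "X \<in> sq2 \<Longrightarrow> intertwines (V.opr X) (W.opr X)"
  by (simp add: intertwines_def hom V.act_carr f_carr sq2_q2)

lemma intertwines_par: "intertwines V.par_op W.par_op"
  unfolding intertwines_def
proof
  fix v assume "v \<in> carr V"
  then obtain v0 v1 where v: "v0 \<in> comp V 0" "v1 \<in> comp V 1" "v = v0 + v1" by (rule V.carrE)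
  note c = V.comp_carr[OF v(1)] V.comp_carr[OF v(2)]
  have "ap V.par_op v = v0 - v1"
    using V.par_comp[OF v(1)] V.par_comp[OF v(2)] v(3) by simp
  moreover have "ap W.par_op (f v) = f v0 - f v1"
    using W.par_comp[OF comp[OF v(1)]] W.par_comp[OF comp[OF v(2)]] v(3) by (simp add: f_add c)
  ultimately show "ap V.par_op v \<in> carr V \<and> f (ap V.par_op v) = ap W.par_op (f v)"
    by (simp add: f_diff c V.subspace_diff[OF V.carr_subspace])
qed

lemma gens_sq2: "block A 0 \<in> sq2" "H 1 - H 2 \<in> sq2" "H 1 + H 2 \<in> sq2" "Ebar \<in> sq2" "Fbar \<in> sq2" "Hbar 1 - Hbar 2 \<in> sq2"
  by (simp_all add: elements)

lemma intertwines_clif: "intertwines V.rel.clif W.rel.clif"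
  and intertwines_ocas: "intertwines V.rel.ocas W.rel.ocas"
  unfolding V.rel.clif_def W.rel.clif_def V.rel.ocas_def W.rel.ocas_def
  by (intro intertwines_ring intertwines_opr gens_sq2)+

lemma intertwines_T: "intertwines V.T_op W.T_op"
  unfolding V.T_op_def W.T_op_def by (intro intertwines_ring intertwines_sc intertwines_ocas)

lemma intertwines_Z: "intertwines (V.Z_op l) (W.Z_op l)"
  unfolding V.Z_op_def W.Z_op_def by (intro intertwines_ring intertwines_sc intertwines_T intertwines_par intertwines_clif)

lemma act_q2:
  assumes "smod scl q2 U" "X \<in> q2" "v \<in> carr U"
  shows "act U X v = act U (sqpart X) v + scl (trh X) (act U odd_unit v)"
proof -
  interpret U: smod scl q2 U by fact
  interpret m: module mscale by (rule module_mscale)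
  have X: "sqpart X + mscale (trh X) odd_unit = X" by (simp add: sqpart_def)
  have "mscale (trh X) odd_unit \<in> q2" by (rule m.subspace_scale[OF U.L_subspace]) (simp add: odd_unit_def)
  then have "act U X v = act U (sqpart X) v + act U (mscale (trh X) odd_unit) v"
    using U.act_add_left[OF sq2_q2[OF sqpart_sq2[OF assms(2)]] _ assms(3), of "mscale (trh X) odd_unit"]
    unfolding X by blast
  then show ?thesis using U.act_mscale[of odd_unit v "trh X"] assms(3) by (simp add: odd_unit_def)
qed

text \<open>\<open>odd_unit\<close> acts by \<open>Z\<close> with some parameter \<open>l\<close> on
  \<open>V\<close> and \<open>m\<close> on \<open>W\<close>. Since \<open>f\<close> transports
  \<open>T^2\<close>, the squares of \<open>l\<close> and \<open>m\<close> agree. If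
  \<open>m = l\<close>, then \<open>f\<close> itself commutes with q; if \<open>m = - l\<close>,
  then \<open>f\<close> followed by \<open>w\<close> does.\<close>

lemma isomorphic_q2: "isomorphic scl q2 V W \<or> isomorphic scl q2 V (parity_change W)"
proof -
  obtain l where l: "V.q_op = V.Z_op l" using V.q_op_eq by blast
  obtain m where m: "W.q_op = W.Z_op m" using W.q_op_eq by blast
  obtain v i where v: "v \<in> comp V i" "v \<noteq> 0" by (rule V.nonzero_vector)
  have vc: "v \<in> carr V" "f v \<in> carr W" using v V.comp_carr f_carr by blast+
  have "f v \<noteq> 0"
  proof
    assume "f v = 0"
    moreover have "f 0 = 0" using f_scl[OF vc(1), of 0] by simp
    moreover have "0 \<in> carr V" using V.comp_carr[OF V.comp_0] .
    ultimately show False using bij vc(1) v(2) by (auto simp: bij_betw_def inj_on_def)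
  qed
  \<comment> \<open>\<open>Z^2 = z\<close> together with \<open>Z_square\<close> determines
    \<open>T^2\<close> as \<open>c + l^2 c^3\<close>.\<close>
  have TV: "ap (V.T_op * V.T_op) v = scl (c + l * l * (c * c * c)) v"
    using V.q_square arg_cong[OF V.Z_square[of l], of "\<lambda>g. ap g v"] vc(1)
    unfolding l V.z_op_eq by (simp add: V.unit_id V.scale_left_distrib algebra_simps)
  have TW: "ap (W.T_op * W.T_op) (f v) = scl (c + m * m * (c * c * c)) (f v)"
    using W.q_square arg_cong[OF W.Z_square[of m], of "\<lambda>g. ap g (f v)"] vc(2)
    unfolding m W.z_op_eq by (simp add: W.unit_id V.scale_left_distrib algebra_simps)
  have "f (ap (V.T_op * V.T_op) v) = ap (W.T_op * W.T_op) (f v)"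
    using intertwines_ring(3)[OF intertwines_T intertwines_T] vc unfolding intertwines_def by blast
  then have "scl (c + l * l * (c * c * c)) (f v) = scl (c + m * m * (c * c * c)) (f v)"
    unfolding TV TW using f_scl vc by simp
  then have "l * l = m * m" using \<open>f v \<noteq> 0\<close> V.c_nz by simp
  then consider "m = l" | "m = - l" by (auto simp: square_eq_iff)
  then show ?thesis
  proof cases
    case 1
    have "isomorphic scl q2 V W"
    proof (rule isomorphicI[OF bij lin comp])
      fix X :: "'k gl22" and v assume X: "X \<in> q2" and v: "v \<in> carr V"
      have "f (act V odd_unit v) = act W odd_unit (f v)"
        using intertwines_Z[of l] v f_carr[OF v] 1 unfolding intertwines_def
        by (metis l m V.ap_opr_carr V.odd_unit_L(1) W.ap_opr_carr)
      then show "f (act V X v) = act W X (f v)"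
        using v f_carr[OF v]
        by (simp add: act_q2[OF V.smod_axioms X] act_q2[OF W.smod_axioms X] f_add f_scl hom sqpart_sq2 X
            V.act_carr sq2_q2 V.subspace_scale[OF V.carr_subspace])
    qed
    then show ?thesis ..
  next
    case 2
    \<comment> \<open>\<open>w\<close> is odd, so this map lands in the parity change of
      \<open>W\<close>.\<close>
    let ?g = "\<lambda>v. ap W.rel.clif (f v)"
    have "isomorphic scl q2 V (parity_change W)"
    proof (rule isomorphicI[of ?g])
      show "bij_betw ?g (carr V) (carr (parity_change W))"
        using bij_betw_trans[OF bij W.clif_bij] by (simp add: o_def)
      show "linear_on_carr scl (carr V) ?g"
        by (simp add: linear_on_carr_def f_add f_scl W.clif_scl)
      show "?g v \<in> comp (parity_change W) i" if "v \<in> comp V i" for v i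
        unfolding comp_parity_change by (rule W.clif_comp[OF comp[OF that]])
    next
      fix X :: "'k gl22" and v assume X: "X \<in> q2" and v: "v \<in> carr V"
      have "f (ap (V.Z_op l) v) = ap (W.Z_op l) (f v)"
        using intertwines_Z[of l] v unfolding intertwines_def by blast
      then have "?g (ap (V.Z_op l) v) = ap (W.Z_op m) (?g v)"
        using arg_cong[OF W.clif_Z[of l], of "\<lambda>h. ap h (f v)"] 2 by simp
      moreover have "act V odd_unit v = ap (V.Z_op l) v"
        unfolding l[symmetric] using v by simp
      moreover have "act W odd_unit (?g v) = ap (W.Z_op m) (?g v)"
        unfolding m[symmetric] using W.clif_carr[OF f_carr[OF v]] by simp
      ultimately have "?g (act V odd_unit v) = act W odd_unit (?g v)" by simp
      then show "?g (act V X v) = act (parity_change W) X (?g v)"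
        using v f_carr[OF v] W.clif_carr[OF f_carr[OF v]]
        by (simp add: act_q2[OF V.smod_axioms X] act_q2[OF W.smod_axioms X] f_add f_scl hom sqpart_sq2 X W.clif_scl W.clif_sq2
            V.act_carr sq2_q2 V.subspace_scale[OF V.carr_subspace])
    qed
    then show ?thesis ..
  qed
qed

end

lemma isomorphic_q2_if_sq2:
  fixes scl :: "'k::{alg_closed_field, field_char_0} \<Rightarrow> 'v::ab_group_add \<Rightarrow> 'v"
  assumes "uncountable (UNIV :: 'k set)" "vector_space scl"
    and VW: "V \<in> simple_typical scl q2" "W \<in> simple_typical scl q2"
    and iso: "isomorphic scl sq2 (res sq2 V) (res sq2 W)"
  shows "isomorphic scl q2 V W \<or> isomorphic scl q2 V (parity_change W)"
proof -
  obtain c where V: "q_simple scl V c" by (rule simple_typical_q_simple[OF assms(1,2) VW(1)])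
  obtain d where W': "q_simple scl W d" by (rule simple_typical_q_simple[OF assms(1,2) VW(2)])
  interpret V: q_simple scl V c by fact
  interpret W': q_simple scl W d by fact
  obtain f where f: "bij_betw f (carr V) (carr W)" "linear_on_carr scl (carr V) f"
    "\<And>i v. v \<in> comp V i \<Longrightarrow> f v \<in> comp W i"
    "\<And>X v. X \<in> sq2 \<Longrightarrow> v \<in> carr V \<Longrightarrow> f (act V X v) = act W X (f v)"
    using iso by (rule isomorphicE) (simp add: act_res)
  \<comment> \<open>The scalars \<open>c\<close> and \<open>d\<close> were obtained separately;
    \<open>f\<close> is surjective and transports the central action, so \<open>c\<close> is valid
    for \<open>W\<close> too.\<close>
  have "act W (H 1 + H 2) w = scl c w" if "w \<in> carr W" for w
  proof -
    obtain v where v: "v \<in> carr V" "w = f v" using f(1) \<open>w \<in> carr W\<close> by (auto simp: bij_betw_def)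
    have "H 1 + H 2 \<in> (sq2 :: 'k gl22 set)" by (simp add: elements)
    then have "act W (H 1 + H 2) w = f (act V (H 1 + H 2) v)" using f(4) v by simp
    also have "\<dots> = scl c w" using V.central f(2) v by (simp add: linear_on_carr_def)
    finally show ?thesis .
  qed
  then have "q_simple scl W c"
    using W'.simple_smod_axioms W'.sq_smod_axioms V.c_nz
    by (intro q_simple.intro simple_typ.intro typ_smod.intro typ_smod_axioms.intro)
  then interpret sq_hom scl V W c f
    using V f by (intro sq_hom.intro sq_hom_axioms.intro)
  show ?thesis by (rule isomorphic_q2)
qed

text \<open>The isomorphism is \<open>w\<close>, which is odd, invertible and commutes with sq
  without signs.\<close>

lemma isomorphic_parity_change_sq2:
  fixes scl :: "'k::{alg_closed_field, field_char_0} \<Rightarrow> 'v::ab_group_add \<Rightarrow> 'v"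
  assumes "uncountable (UNIV :: 'k set)" "vector_space scl" and V: "V \<in> simple_typical scl sq2"
  shows "isomorphic scl sq2 (parity_change V) V"
proof -
  obtain c where "sq_simple scl V c" by (rule simple_typical_sq_simple[OF assms])
  then interpret sq_simple scl V c .
  show ?thesis
  proof (rule isomorphicI[of "ap rel.clif"])
    show "ap rel.clif v \<in> comp V i" if "v \<in> comp (parity_change V) i" for v i
      using clif_comp[of v "i + 1"] that by (cases i) simp_all
  qed (simp_all add: clif_bij clif_sq2 linear_on_carr_def clif_scl)
qed

lemma isomorphic_res:
  assumes "isomorphic scl q2 V W" shows "isomorphic scl sq2 (res sq2 V) (res sq2 W)"
proof -
  obtain f where f: "bij_betw f (carr V) (carr W)" "linear_on_carr scl (carr V) f"
    "\<And>i v. v \<in> comp V i \<Longrightarrow> f v \<in> comp W i"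
    "\<And>X v. X \<in> q2 \<Longrightarrow> v \<in> carr V \<Longrightarrow> f (act V X v) = act W X (f v)"
    using assms by (rule isomorphicE) blast
  show ?thesis
    by (rule isomorphicI[of f]) (simp_all add: f act_res sq2_q2)
qed

text \<open>Because restriction respects the equivalence relations, all members of a class
  contribute the same set to the union, which is therefore the class of their restrictions; the
  union formula is the induced map on classes.\<close>

theorem proposition26:
  fixes scl :: "'k::{alg_closed_field, field_char_0} \<Rightarrow> 'v::ab_group_add \<Rightarrow> 'v"
  assumes "uncountable (UNIV :: 'k set)"
    and "vector_space scl"
  shows "(\<forall>V \<in> simple_typical scl q2. res sq2 V \<in> simple_typical scl sq2) \<and>
    (\<lambda>V. iso_up_to_parity scl sq2 `` {res sq2 V}) respects iso_up_to_parity scl q2 \<and>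
    bij_betw (\<lambda>C. \<Union>V\<in>C. iso_up_to_parity scl sq2 `` {res sq2 V})
      (iso_classes scl q2) (iso_classes scl sq2)"
proof -
  have res: "res sq2 V \<in> simple_typical scl sq2" if "V \<in> simple_typical scl q2" for V
    by (rule simple_typical_q_simple[OF assms that]) (rule q_simple.res_simple_typical)
  have res_parity: "res sq2 (parity_change V) = parity_change (res sq2 V)" for V :: "('k, 'v) supermod"
    by (simp add: res_def parity_change_def)
  have iff: "(V, W) \<in> iso_up_to_parity scl q2 \<longleftrightarrow> (res sq2 V, res sq2 W) \<in> iso_up_to_parity scl sq2"
    if VW: "V \<in> simple_typical scl q2" "W \<in> simple_typical scl q2" for V W
  proof
    assume "(V, W) \<in> iso_up_to_parity scl q2"
    then have "isomorphic scl sq2 (res sq2 V) (res sq2 W) \<or> isomorphic scl sq2 (res sq2 V) (res sq2 (parity_change W))"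
      using isomorphic_res by (auto simp: iso_up_to_parity_def)
    then show "(res sq2 V, res sq2 W) \<in> iso_up_to_parity scl sq2"
      using res VW by (simp add: iso_up_to_parity_def res_parity)
  next
    assume "(res sq2 V, res sq2 W) \<in> iso_up_to_parity scl sq2"
    \<comment> \<open>For sq the alternative with a parity change reduces to the plain one, since
      each restriction is isomorphic to its own parity change.\<close>
    then have "isomorphic scl sq2 (res sq2 V) (res sq2 W)"
      using isomorphic_trans[OF _ isomorphic_parity_change_sq2[OF assms res[OF VW(2)]]] by (auto simp: iso_up_to_parity_def)
    from isomorphic_q2_if_sq2[OF assms VW this]
    show "(V, W) \<in> iso_up_to_parity scl q2" using VW by (simp add: iso_up_to_parity_def)
  qed
  have surj: "\<exists>U\<in>simple_typical scl q2. (res sq2 U, W) \<in> iso_up_to_parity scl sq2"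
    if W: "W \<in> simple_typical scl sq2" for W
  proof -
    obtain c where "sq_simple scl W c" by (rule simple_typical_sq_simple[OF assms W])
    then obtain U where "U \<in> simple_typical scl q2" "isomorphic scl sq2 (res sq2 U) W"
      using sq_simple.ex_extension by blast
    then show ?thesis using res W by (auto simp: iso_up_to_parity_def)
  qed
  note eq = equiv_iso_up_to_parity[OF assms(2) subsuperalgebra_q2] equiv_iso_up_to_parity[OF assms(2) subsuperalgebra_sq2]
  have "res sq2 ` simple_typical scl q2 \<subseteq> simple_typical scl sq2" using res by blast
  note bij = bij_betw_quotient_map[OF eq this iff surj]
  show ?thesis using res bij unfolding iso_classes_def by blast
qed

end
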